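(* There is an absolute constant $C$ such that, for all integers $d\geq 1$ and $n\geq 1$ with $dn\geq 2$, $$\binom{d}{2}+d(n-d)=dn-\binom{d+1}{2}\;\leq\;\operatorname{ex}_{\mathbb{R}^d}(n)\;\leq\; dn+(2+2\ln 2)\,\frac{dn}{\ln(dn)}+C\,\frac{dn}{(\ln(dn))^{2}}.$$ In particular, $\operatorname{ex}_{\mathbb{R}^d}(n)=dn+O(n/\ln n)$ as $n\to\infty$ for every fixed $d\geq 1$.
   Context: Graphs are finite and simple. For a graph $G=(V,E)$ and a total order $\prec$ on $E$, we say that $\prec$ is realizable in $\mathbb{R}^d$ if there is an injection $p\colon V\to\mathbb{R}^d$ such that the Euclidean edge lengths $\|p(u)-p(v)\|$, $uv\in E$, are pairwise distinct and, for all distinct edges $uv,xy\in E$, $uv\prec xy$ if and only if $\|p(u)-p(v)\|<\|p(x)-p(y)\|$. The quantity $\operatorname{ex}_{\mathbb{R}^d}(n)$ is the maximum of $|E(G)|$ over all graphs $G$ on $n$ vertices such that every total order on $E(G)$ is realizable in $\mathbb{R}^d$. *)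

theory Defs
  imports "HOL-Analysis.Analysis" "HOL-Library.Landau_Symbols"
begin

definition simple_graph :: "'v set \<Rightarrow> 'v set set \<Rightarrow> bool" where
  "simple_graph V E \<longleftrightarrow> finite V \<and> E \<subseteq> {e. e \<subseteq> V \<and> card e = 2}"

(* Since the dimension d is quantified over inside the theorem, R^d is rendered as
   topspace (Euclidean_space d), the functions nat => real vanishing outside {..<d}. *)
definition edist :: "nat \<Rightarrow> (nat \<Rightarrow> real) \<Rightarrow> (nat \<Rightarrow> real) \<Rightarrow> real" where
  "edist d x y = L2_set (\<lambda>i. x i - y i) {..<d}"

(* A total order on E is given by its reflexive relation r, as in linear_order_on;
   for distinct edges e and f, membership (e, f) \<in> r says that e strictly precedes f. *)
definition realizable :: "nat \<Rightarrow> 'v set \<Rightarrow> 'v set set \<Rightarrow> 'v set rel \<Rightarrow> bool" where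
  "realizable d V E r \<longleftrightarrow>
     (\<exists>p. p \<in> V \<rightarrow> topspace (Euclidean_space d) \<and> inj_on p V \<and>
        (\<forall>u v x y. {u, v} \<in> E \<and> {x, y} \<in> E \<and> {u, v} \<noteq> {x, y} \<longrightarrow>
           edist d (p u) (p v) \<noteq> edist d (p x) (p y) \<and>
           (({u, v}, {x, y}) \<in> r \<longleftrightarrow> edist d (p u) (p v) < edist d (p x) (p y))))"

definition all_orders_realizable :: "nat \<Rightarrow> 'v set \<Rightarrow> 'v set set \<Rightarrow> bool" where
  "all_orders_realizable d V E \<longleftrightarrow> (\<forall>r. linear_order_on E r \<longrightarrow> realizable d V E r)"

(* Vertices are taken from nat, which loses nothing up to isomorphism. *)
definition edge_counts :: "nat \<Rightarrow> nat \<Rightarrow> nat set" where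
  "edge_counts d n =
     {card E | V E. simple_graph (V :: nat set) E \<and> card V = n \<and> all_orders_realizable d V E}"

definition ex_euclidean :: "nat \<Rightarrow> nat \<Rightarrow> nat" where
  "ex_euclidean d n = Max (edge_counts d n)"

(* The maximum is taken over a finite set, which is nonempty when d \<ge> 1. *)
lemma finite_edge_counts: "finite (edge_counts d n)"
proof (rule finite_subset)
  show "edge_counts d n \<subseteq> {..n choose 2}"
  proof
    fix k assume "k \<in> edge_counts d n"
    then obtain V :: "nat set" and E where
      "finite V" "card V = n" "E \<subseteq> {e. e \<subseteq> V \<and> card e = 2}" "k = card E"
      by (auto simp: edge_counts_def simple_graph_def)
    then show "k \<in> {..n choose 2}"
      using card_mono[of "{e. e \<subseteq> V \<and> card e = 2}" E] n_subsets[of V 2] by simp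
  qed
qed simp

lemma edge_counts_nonempty:
  assumes "d \<ge> 1"
  shows "edge_counts d n \<noteq> {}"
proof -
  let ?p = "\<lambda>(v::nat) (i::nat). if i = 0 then real v else 0"
  have "?p \<in> {..<n} \<rightarrow> topspace (Euclidean_space d)"
    using assms by (auto simp: topspace_Euclidean_space)
  moreover have "inj_on ?p {..<n}"
    by (auto simp: inj_on_def dest: fun_cong[where x = 0])
  ultimately have "all_orders_realizable d {..<n} {}"
    unfolding all_orders_realizable_def realizable_def by blast
  then have "card ({} :: nat set set) \<in> edge_counts d n"
    unfolding edge_counts_def simple_graph_def
    by (intro CollectI exI[of _ "{..<n}"] exI[of _ "{}"]) auto
  then show ?thesis by blast
qed

end

theory Submission
  imports Defs
begin

text \<open>
Lower bound: join a clique on \<open>d\<close> vertices to the remaining \<open>n - d\<close> vertices, which stay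
pairwise nonadjacent. This graph has a configuration, possibly with coinciding points, in which all
edges have the same length and the first-order changes of the edge lengths can be prescribed
independently of each other. Hence every order of the edges is realized by a small displacement
(lemmas \<open>realizable_of_first_order\<close> and \<open>clique_join_all_orders\<close>).

Upper bound: the coordinates of the \<open>n\<close> points are \<open>N = d * n\<close> real numbers, and the order
of the lengths of \<open>m\<close> edges is determined by the signs of fewer than \<open>m\<^sup>2 / 2\<close> quadratic
forms in these numbers, one for each pair of edges. If all \<open>fact m\<close> orders are realizable, these
forms have at least \<open>fact m\<close> sign patterns. By a bound of Warren's type there are at most
\<open>(4 * exp 1 * m\<^sup>2 / N) ^ N\<close> of them when \<open>m > N\<close>, and comparing logarithms gives the claim
(\<open>fact_le_patterns\<close>, \<open>card_patterns\<close>, \<open>fact_le_implies_near_linear\<close>).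

The bound on sign patterns is proved by elementary means. Perturb the polynomials generically and
choose a generic point \<open>a\<close>. Each sign pattern belongs to a closed region, in which there is a
point \<open>x\<close> nearest to \<open>a\<close>. If \<open>J\<close> is the set of polynomials vanishing at \<open>x\<close>, then
their gradients are independent, so \<open>J\<close> has at most \<open>N\<close> elements, and \<open>x\<close> solves the
Lagrange equations for \<open>J\<close>: a square system of \<open>N + card J\<close> quadratic equations, which has at
most \<open>2 ^ (N + card J)\<close> solutions. The pattern is determined by \<open>J\<close>, \<open>x\<close> and the signs
assigned to the members of \<open>J\<close>, and it remains to sum \<open>2 ^ (N + card J) * 2 ^ card J\<close> over all
sets \<open>J\<close> of size at most \<open>N\<close>.

Two facts about a generic choice enter here: gradients of simultaneously vanishing polynomials are
independent, and the Lagrange system has no more solutions than the product of its degrees. Both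
are obtained by counting dimensions of spaces of polynomials, without differentiation or
intersection theory (\<open>generic_not_in_image\<close>, \<open>generic_fibre_card\<close>).
\<close>

section \<open>Polynomial functions of finitely many variables\<close>

text \<open>Exponent vectors are made to vanish outside \<open>I\<close> so that each monomial in the variables
\<open>I\<close> is listed exactly once.\<close>

definition exponents :: "'a set \<Rightarrow> nat \<Rightarrow> ('a \<Rightarrow> nat) set" where
  "exponents I D = {e. (\<forall>i. i \<notin> I \<longrightarrow> e i = 0) \<and> sum e I \<le> D}"

definition monomial :: "'a set \<Rightarrow> ('a \<Rightarrow> nat) \<Rightarrow> ('a \<Rightarrow> real) \<Rightarrow> real" where
  "monomial I e x = (\<Prod>i\<in>I. x i ^ e i)"

definition poly_upto :: "'a set \<Rightarrow> nat \<Rightarrow> (('a \<Rightarrow> real) \<Rightarrow> real) set" where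
  "poly_upto I D = {p. \<exists>c. \<forall>x. p x = (\<Sum>e\<in>exponents I D. c e * monomial I e x)}"

lemma poly_uptoI: "(\<And>x. p x = (\<Sum>e\<in>exponents I D. c e * monomial I e x)) \<Longrightarrow> p \<in> poly_upto I D"
  unfolding poly_upto_def by blast

lemma finite_exponents:
  assumes "finite I"
  shows "finite (exponents I D)"
proof (rule finite_subset)
  show "exponents I D \<subseteq> {e. \<forall>i. (i \<in> I \<longrightarrow> e i \<in> {..D}) \<and> (i \<notin> I \<longrightarrow> e i = 0)}"
    using assms by (auto simp: exponents_def intro: order_trans[OF member_le_sum[where f = "_ :: _ \<Rightarrow> nat"]])
  show "finite {e. \<forall>i. (i \<in> I \<longrightarrow> e i \<in> {..D}) \<and> (i \<notin> I \<longrightarrow> e i = (0::nat))}"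
    using assms by (intro finite_set_of_finite_funs) auto
qed

lemma exponents_insert:
  assumes "finite I" "a \<notin> I"
  shows "exponents (insert a I) D = (\<Union>k\<in>{0..D}. (\<lambda>e. e(a := D - k)) ` exponents I k)"
proof (intro equalityI subsetI)
  fix e assume "e \<in> exponents (insert a I) D"
  then have e: "\<forall>i. i \<notin> insert a I \<longrightarrow> e i = 0" "e a + sum e I \<le> D"
    using assms by (auto simp: exponents_def)
  have "sum (e(a := 0)) I = sum e I"
    using assms by (intro sum.cong) auto
  then have "e(a := 0) \<in> exponents I (D - e a)"
    using e by (auto simp: exponents_def)
  moreover have "e = (e(a := 0))(a := D - (D - e a))" "D - e a \<in> {0..D}"
    using e by auto
  ultimately show "e \<in> (\<Union>k\<in>{0..D}. (\<lambda>e. e(a := D - k)) ` exponents I k)"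
    by blast
next
  fix e' assume "e' \<in> (\<Union>k\<in>{0..D}. (\<lambda>e. e(a := D - k)) ` exponents I k)"
  then obtain k e where k: "k \<le> D" and e: "e \<in> exponents I k" and e': "e' = e(a := D - k)"
    by auto
  have "sum (e(a := D - k)) I = sum e I"
    using assms by (intro sum.cong) auto
  then show "e' \<in> exponents (insert a I) D"
    using e k assms unfolding e' by (auto simp: exponents_def)
qed

lemma card_exponents:
  assumes "finite I"
  shows "card (exponents I D) = (card I + D) choose D"
  using assms
proof (induction I arbitrary: D rule: finite_induct)
  case empty
  have "exponents {} D = {\<lambda>i::'a. 0}"
    by (auto simp: exponents_def)
  then show ?case by simp
next
  case (insert a I)
  have "card (exponents (insert a I) D)
      = (\<Sum>k\<in>{0..D}. card ((\<lambda>e. e(a := D - k)) ` exponents I k))"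
    unfolding exponents_insert[OF insert(1,2)]
  proof (rule card_UN_disjoint)
    show "\<forall>i\<in>{0..D}. \<forall>j\<in>{0..D}. i \<noteq> j \<longrightarrow>
       (\<lambda>e. e(a := D - i)) ` exponents I i \<inter> (\<lambda>e. e(a := D - j)) ` exponents I j = {}"
    proof (intro ballI impI)
      fix i j assume ij: "i \<in> {0..D}" "j \<in> {0..D}" "i \<noteq> j"
      have "D - i \<noteq> D - j" using ij by auto
      then show "(\<lambda>e. e(a := D - i)) ` exponents I i \<inter> (\<lambda>e. e(a := D - j)) ` exponents I j = {}"
        by (auto dest: fun_cong[where x = a])
    qed
  qed (use finite_exponents[OF insert(1)] in auto)
  also have "\<dots> = (\<Sum>k\<in>{0..D}. card (exponents I k))"
  proof (intro sum.cong refl card_image inj_onI)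
    fix k e e' assume e: "e \<in> exponents I k" "e' \<in> exponents I k" "e(a := D - k) = e'(a := D - k)"
    have "e a = 0" "e' a = 0" using e insert(2) by (auto simp: exponents_def)
    then show "e = e'" using e(3) by (metis fun_upd_triv fun_upd_upd)
  qed
  also have "\<dots> = (\<Sum>k=0..D. (card I + k) choose k)"
    using insert.IH by simp
  also have "\<dots> = (card (insert a I) + D) choose D"
    unfolding atMost_atLeast0[symmetric] sum_choose_lower using insert(1,2) by simp
  finally show ?case .
qed

lemma poly_upto_sum:
  assumes "\<And>a. a \<in> A \<Longrightarrow> p a \<in> poly_upto I D"
  shows "(\<lambda>x. \<Sum>a\<in>A. p a x) \<in> poly_upto I D"
proof -
  from assms have "\<forall>a. \<exists>c. a \<in> A \<longrightarrow> (\<forall>x. p a x = (\<Sum>e\<in>exponents I D. c e * monomial I e x))"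
    unfolding poly_upto_def by blast
  then obtain c where
    c: "\<And>a x. a \<in> A \<Longrightarrow> p a x = (\<Sum>e\<in>exponents I D. c a e * monomial I e x)"
    by metis
  have "(\<Sum>a\<in>A. p a x) = (\<Sum>e\<in>exponents I D. (\<Sum>a\<in>A. c a e) * monomial I e x)" for x
    by (simp add: c sum_distrib_right sum.swap[of _ A])
  then show ?thesis by (rule poly_uptoI)
qed

lemma poly_upto_cmult:
  assumes "p \<in> poly_upto I D"
  shows "(\<lambda>x. k * p x) \<in> poly_upto I D"
proof -
  obtain c where c: "\<And>x. p x = (\<Sum>e\<in>exponents I D. c e * monomial I e x)"
    using assms unfolding poly_upto_def by blast
  have "k * p x = (\<Sum>e\<in>exponents I D. (k * c e) * monomial I e x)" for x
    by (simp add: c sum_distrib_left mult.assoc)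
  then show ?thesis by (rule poly_uptoI)
qed

lemma poly_upto_monomial:
  assumes "finite I" "e \<in> exponents I D"
  shows "monomial I e \<in> poly_upto I D"
proof -
  have "monomial I e x = (\<Sum>e'\<in>exponents I D. (if e' = e then 1 else 0) * monomial I e' x)" for x
    using assms finite_exponents[OF assms(1)] by (simp add: if_distrib [of "\<lambda>a. a * _"] cong: if_cong)
  then show ?thesis by (rule poly_uptoI)
qed

lemma poly_upto_const: "finite I \<Longrightarrow> (\<lambda>x. k) \<in> poly_upto I D"
  using poly_upto_cmult[OF poly_upto_monomial[of I "\<lambda>_. 0" D], of k]
  by (simp add: exponents_def monomial_def)

lemma poly_upto_var:
  assumes "finite I" "i \<in> I" "D \<ge> 1"
  shows "(\<lambda>x. x i) \<in> poly_upto I D"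
proof -
  have "monomial I (\<lambda>j. if j = i then 1 else 0) = (\<lambda>x. x i)"
    using assms by (simp add: monomial_def fun_eq_iff if_distrib[of "\<lambda>a. _ ^ a"] cong: if_cong)
  moreover have "(\<lambda>j. if j = i then 1 else 0) \<in> exponents I D"
    using assms by (auto simp: exponents_def)
  ultimately show ?thesis using poly_upto_monomial[OF assms(1)] by metis
qed

lemma poly_upto_add:
  assumes "p \<in> poly_upto I D" "q \<in> poly_upto I D"
  shows "(\<lambda>x. p x + q x) \<in> poly_upto I D"
  using poly_upto_sum[of "{True, False}" "\<lambda>b. if b then p else q" I D] assms by simp

lemma poly_upto_uminus:
  assumes "p \<in> poly_upto I D"
  shows "(\<lambda>x. - p x) \<in> poly_upto I D"
  using poly_upto_cmult[OF assms, of "-1"] by simp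

lemma poly_upto_diff:
  assumes "p \<in> poly_upto I D" "q \<in> poly_upto I D"
  shows "(\<lambda>x. p x - q x) \<in> poly_upto I D"
  using poly_upto_add[OF assms(1) poly_upto_uminus[OF assms(2)]] by simp

lemma poly_upto_mult:
  assumes "finite I" "p \<in> poly_upto I D" "q \<in> poly_upto I D'"
  shows "(\<lambda>x. p x * q x) \<in> poly_upto I (D + D')"
proof -
  obtain c where c: "\<And>x. p x = (\<Sum>e\<in>exponents I D. c e * monomial I e x)"
    using assms unfolding poly_upto_def by blast
  obtain c' where c': "\<And>x. q x = (\<Sum>e\<in>exponents I D'. c' e * monomial I e x)"
    using assms unfolding poly_upto_def by blast
  have "p x * q x = (\<Sum>e\<in>exponents I D. \<Sum>e'\<in>exponents I D'.
      (c e * c' e') * monomial I (\<lambda>i. e i + e' i) x)" for x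
    by (simp add: c c' sum_product monomial_def power_add prod.distrib mult.assoc mult.left_commute)
  moreover have "(\<lambda>x. \<Sum>e\<in>exponents I D. \<Sum>e'\<in>exponents I D'.
      (c e * c' e') * monomial I (\<lambda>i. e i + e' i) x) \<in> poly_upto I (D + D')"
    by (intro poly_upto_sum poly_upto_cmult poly_upto_monomial assms)
       (auto simp: exponents_def sum.distrib)
  ultimately show ?thesis by presburger
qed

lemma poly_upto_mono:
  assumes "finite I'" "I \<subseteq> I'" "D \<le> D'"
  shows "poly_upto I D \<subseteq> poly_upto I' D'"
proof
  fix p assume "p \<in> poly_upto I D"
  then obtain c where c: "\<And>x. p x = (\<Sum>e\<in>exponents I D. c e * monomial I e x)"
    unfolding poly_upto_def by blast
  have "monomial I e = monomial I' e" "e \<in> exponents I' D'" if "e \<in> exponents I D" for e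
  proof -
    have z: "\<forall>i\<in>I' - I. e i = 0" using that by (auto simp: exponents_def)
    show "monomial I e = monomial I' e"
      unfolding monomial_def using assms z by (intro ext prod.mono_neutral_left) auto
    have "sum e I = sum e I'" using assms z by (intro sum.mono_neutral_left) auto
    then show "e \<in> exponents I' D'" using that assms by (auto simp: exponents_def)
  qed
  then have "(\<lambda>x. \<Sum>e\<in>exponents I D. c e * monomial I e x) \<in> poly_upto I' D'"
    using assms by (intro poly_upto_sum poly_upto_cmult) (simp add: poly_upto_monomial)
  moreover have "p = (\<lambda>x. \<Sum>e\<in>exponents I D. c e * monomial I e x)" using c by blast
  ultimately show "p \<in> poly_upto I' D'" by simp
qed

lemma poly_upto_power:
  assumes "finite I" "p \<in> poly_upto I D"
  shows "(\<lambda>x. p x ^ k) \<in> poly_upto I (D * k)"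
proof (induction k)
  case 0
  then show ?case using poly_upto_const[OF assms(1), of 1] by simp
next
  case (Suc k)
  then show ?case using poly_upto_mult[OF assms Suc] by (simp add: algebra_simps)
qed

lemma poly_upto_monomial_subst:
  assumes "finite I" "finite K" "\<And>k. k \<in> K \<Longrightarrow> F k \<in> poly_upto I D"
  shows "(\<lambda>x. monomial K e (\<lambda>k. F k x)) \<in> poly_upto I (D * sum e K)"
  using assms(2,3)
proof (induction K rule: finite_induct)
  case empty
  then show ?case using poly_upto_const[OF assms(1), of 1] by (simp add: monomial_def)
next
  case (insert k K)
  have "(\<lambda>x. F k x ^ e k * monomial K e (\<lambda>k. F k x)) \<in> poly_upto I (D * e k + D * sum e K)"
    using insert.IH insert.prems by (intro poly_upto_mult poly_upto_power assms(1)) auto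
  then show ?case using insert(1,2) by (simp add: monomial_def algebra_simps)
qed

text \<open>By induction on the variables: for fixed values of the other variables, vanishing for every value
of \<open>y k\<close> kills the coefficient of each power of \<open>y k\<close>, and these coefficients are
polynomials of the same shape in one variable less. Exponent vectors are compared on \<open>K\<close>
only, because those sharing the exponent of \<open>k\<close> are not zero outside the smaller set.\<close>

lemma monomial_separates:
  assumes "finite K" "finite S" "inj_on (\<lambda>e. restrict e K) S"
    and "\<And>y. (\<Sum>e\<in>S. c e * monomial K e y) = 0"
  shows "\<forall>e\<in>S. c e = 0"
  using assms
proof (induction K arbitrary: S c rule: finite_induct)
  case empty
  have "e = e'" if "e \<in> S" "e' \<in> S" for e e'
    using empty(2) that by (auto simp: inj_on_def)
  then have "S = {} \<or> (\<exists>e. S = {e})" by blast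
  then show ?case using empty(3)[of "\<lambda>_. 0"] by (auto simp: monomial_def)
next
  case (insert k K)
  show ?case
  proof
    fix e0 assume e0: "e0 \<in> S"
    let ?S = "\<lambda>n. {e \<in> S. e k = n}"
    obtain B where B: "\<And>e. e \<in> S \<Longrightarrow> e k \<le> B"
      using finite_nat_set_iff_bounded_le[of "(\<lambda>e. e k) ` S"] insert(4) by auto
    have "(\<Sum>e\<in>?S (e0 k). c e * monomial K e y) = 0" for y
    proof -
      let ?a = "\<lambda>n. \<Sum>e\<in>?S n. c e * monomial K e y"
      have "(\<Sum>n\<le>B. ?a n * t ^ n) = 0" for t
      proof -
        have "(\<Sum>n\<le>B. ?a n * t ^ n) = (\<Sum>n\<le>B. \<Sum>e\<in>?S n. c e * (t ^ e k * monomial K e y))"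
          by (intro sum.cong refl) (auto simp: sum_distrib_left mult_ac intro!: sum.cong)
        also have "\<dots> = (\<Sum>e\<in>S. c e * (t ^ e k * monomial K e y))"
          using insert(4) B by (intro sum.group) auto
        also have "\<dots> = (\<Sum>e\<in>S. c e * monomial (insert k K) e (y(k := t)))"
        proof (intro sum.cong refl)
          fix e
          have "monomial K e (y(k := t)) = monomial K e y"
            using insert(2) unfolding monomial_def by (intro prod.cong) auto
          then show "c e * (t ^ e k * monomial K e y) = c e * monomial (insert k K) e (y(k := t))"
            using insert(1,2) by (simp add: monomial_def)
        qed
        finally show ?thesis using insert(6) by simp
      qed
      then have "\<forall>n\<le>B. ?a n = 0"
        using polyfun_eq_0[of ?a B] by simp
      then show ?thesis using B[OF e0] by blast
    qed
    moreover have "inj_on (\<lambda>e. restrict e K) (?S (e0 k))"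
    proof (rule inj_onI)
      fix e e' assume e: "e \<in> ?S (e0 k)" "e' \<in> ?S (e0 k)" "restrict e K = restrict e' K"
      have "restrict e (insert k K) = restrict e' (insert k K)"
      proof
        fix i show "restrict e (insert k K) i = restrict e' (insert k K) i"
          using e(1,2) fun_cong[OF e(3), of i] by (cases "i \<in> K") (simp_all add: restrict_def)
      qed
      then show "e = e'" by (rule inj_onD[OF insert(5)]) (use e in auto)
    qed
    moreover have "finite (?S (e0 k))" using insert(4) by simp
    ultimately have "\<forall>e\<in>?S (e0 k). c e = 0" by (intro insert.IH)
    then show "c e0 = 0" using e0 by blast
  qed
qed

lemma monomial_independent:
  assumes "finite K" "\<And>y. (\<Sum>e\<in>exponents K D. c e * monomial K e y) = 0" "e \<in> exponents K D"
  shows "c e = 0"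
proof -
  have "inj_on (\<lambda>e. restrict e K) (exponents K D)"
  proof (rule inj_onI)
    fix e e' assume e: "e \<in> exponents K D" "e' \<in> exponents K D" "restrict e K = restrict e' K"
    show "e = e'"
    proof
      fix i show "e i = e' i"
        using e(1,2) fun_cong[OF e(3), of i] by (cases "i \<in> K") (simp_all add: exponents_def)
    qed
  qed
  then show ?thesis
    using monomial_separates[of K "exponents K D" c] assms finite_exponents[OF assms(1)] by blast
qed

lemma poly_upto_on_line:
  assumes "finite I" "p \<in> poly_upto I D"
  shows "\<exists>r. \<forall>t. p (\<lambda>i. x i + t * v i) = poly r t"
proof -
  obtain c where c: "\<And>x. p x = (\<Sum>e\<in>exponents I D. c e * monomial I e x)"
    using assms unfolding poly_upto_def by blast
  have "p (\<lambda>i. x i + t * v i)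
      = poly (\<Sum>e\<in>exponents I D. smult (c e) (\<Prod>i\<in>I. [:x i, v i:] ^ e i)) t" for t
    by (simp add: c monomial_def poly_sum poly_prod)
  then show ?thesis by blast
qed

text \<open>More unknowns than homogeneous equations; Gaussian elimination, one equation at a time.\<close>

lemma nontrivial_relation:
  fixes m :: "'a \<Rightarrow> 'b \<Rightarrow> real"
  assumes "finite B" "finite A" "card B < card A"
  shows "\<exists>c. (\<exists>a\<in>A. c a \<noteq> 0) \<and> (\<forall>b\<in>B. (\<Sum>a\<in>A. c a * m a b) = 0)"
  using assms
proof (induction B arbitrary: A m rule: finite_induct)
  case empty
  then show ?case by (intro exI[of _ "\<lambda>_. 1"]) (auto simp: card_gt_0_iff)
next
  case (insert b B)
  show ?case
  proof (cases "\<forall>a\<in>A. m a b = 0")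
    case True
    have "card B < card A" using insert by simp
    from insert.IH[OF insert(4) this, of m] show ?thesis using True by auto
  next
    case False
    then obtain a0 where a0: "a0 \<in> A" "m a0 b \<noteq> 0" by auto
    let ?m = "\<lambda>a b'. m a b' - m a b / m a0 b * m a0 b'"
    have "card B < card (A - {a0})" using insert a0 by simp
    from insert.IH[OF _ this, of ?m] insert(4) obtain c where
      c: "\<exists>a\<in>A - {a0}. c a \<noteq> 0" "\<forall>b'\<in>B. (\<Sum>a\<in>A - {a0}. c a * ?m a b') = 0" by auto
    \<comment> \<open>The coefficient of \<open>a0\<close> is chosen to satisfy the equation for \<open>b\<close>.\<close>
    let ?c = "c(a0 := - (\<Sum>a\<in>A - {a0}. c a * (m a b / m a0 b)))"
    have eq: "(\<Sum>a\<in>A. ?c a * m a b') = (\<Sum>a\<in>A - {a0}. c a * ?m a b')" for b'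
    proof -
      have "(\<Sum>a\<in>A. ?c a * m a b') = ?c a0 * m a0 b' + (\<Sum>a\<in>A - {a0}. ?c a * m a b')"
        using insert(4) a0(1) by (rule sum.remove)
      also have "(\<Sum>a\<in>A - {a0}. ?c a * m a b') = (\<Sum>a\<in>A - {a0}. c a * m a b')"
        by (intro sum.cong) auto
      finally show ?thesis
        by (simp add: algebra_simps sum_subtractf sum_distrib_left)
    qed
    have "(\<Sum>a\<in>A. ?c a * m a b) = 0" unfolding eq using a0 by simp
    moreover have "\<forall>b'\<in>B. (\<Sum>a\<in>A. ?c a * m a b') = 0" unfolding eq using c by blast
    moreover have "\<exists>a\<in>A. ?c a \<noteq> 0" using c(1) by (metis DiffE fun_upd_other singletonI)
    ultimately show ?thesis by (intro exI[of _ ?c]) auto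
  qed
qed

text \<open>The dimension count behind all later bounds: a family with more members than there are monomials
of degree at most \<open>D\<close> is linearly dependent.\<close>

lemma poly_upto_dependent:
  assumes "finite I" "finite A" "(card I + D) choose D < card A"
    and "\<And>a. a \<in> A \<Longrightarrow> p a \<in> poly_upto I D"
  shows "\<exists>c. (\<exists>a\<in>A. c a \<noteq> 0) \<and> (\<forall>x. (\<Sum>a\<in>A. c a * p a x) = 0)"
proof -
  from assms(4) have "\<forall>a. \<exists>c. a \<in> A \<longrightarrow> (\<forall>x. p a x = (\<Sum>e\<in>exponents I D. c e * monomial I e x))"
    unfolding poly_upto_def by blast
  then obtain m where
    m: "\<And>a x. a \<in> A \<Longrightarrow> p a x = (\<Sum>e\<in>exponents I D. m a e * monomial I e x)"
    by metis
  obtain c where c: "\<exists>a\<in>A. c a \<noteq> 0" "\<forall>e\<in>exponents I D. (\<Sum>a\<in>A. c a * m a e) = 0"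
    using nontrivial_relation[OF finite_exponents[OF assms(1)] assms(2), of D m] assms(3)
      card_exponents[OF assms(1), of D] by auto
  have "(\<Sum>a\<in>A. c a * p a x) = 0" for x
  proof -
    have "(\<Sum>a\<in>A. c a * p a x) = (\<Sum>a\<in>A. \<Sum>e\<in>exponents I D. c a * m a e * monomial I e x)"
      by (intro sum.cong) (auto simp: m sum_distrib_left mult.assoc)
    also have "\<dots> = (\<Sum>e\<in>exponents I D. (\<Sum>a\<in>A. c a * m a e) * monomial I e x)"
      by (subst sum.swap) (simp add: sum_distrib_right)
    also have "\<dots> = 0" using c by simp
    finally show ?thesis .
  qed
  then show ?thesis using c by blast
qed

definition is_poly :: "'a set \<Rightarrow> (('a \<Rightarrow> real) \<Rightarrow> real) \<Rightarrow> bool" where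
  "is_poly A p \<longleftrightarrow> (\<exists>D. p \<in> poly_upto A D)"

lemma is_poly_common_degree:
  assumes "finite A" "finite K" "\<And>k. k \<in> K \<Longrightarrow> is_poly A (G k)"
  shows "\<exists>D. \<forall>k\<in>K. G k \<in> poly_upto A D"
proof -
  from assms(3) have "\<forall>k\<in>K. \<exists>D. G k \<in> poly_upto A D" unfolding is_poly_def by blast
  from bchoice[OF this] obtain d where d: "\<forall>k\<in>K. G k \<in> poly_upto A (d k)" by blast
  have "G k \<in> poly_upto A (sum d K)" if "k \<in> K" for k
    using d that member_le_sum[OF that, of d] assms(2)
      subsetD[OF poly_upto_mono[OF assms(1) order_refl, of "d k" "sum d K"]] by simp
  then show ?thesis by blast
qed

lemma is_poly_const: "finite A \<Longrightarrow> is_poly A (\<lambda>x. k)"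
  unfolding is_poly_def by (intro exI[of _ 0] poly_upto_const)

lemma is_poly_var: "finite A \<Longrightarrow> a \<in> A \<Longrightarrow> is_poly A (\<lambda>x. x a)"
  unfolding is_poly_def by (intro exI[of _ 1] poly_upto_var order_refl)

lemma is_poly_mult:
  assumes "finite A" "is_poly A p" "is_poly A q"
  shows "is_poly A (\<lambda>x. p x * q x)"
proof -
  obtain D D' where "p \<in> poly_upto A D" "q \<in> poly_upto A D'"
    using assms(2,3) unfolding is_poly_def by (elim exE)
  from poly_upto_mult[OF assms(1) this] show ?thesis unfolding is_poly_def by (rule exI)
qed

lemma is_poly_sum:
  assumes "finite A" "finite T" "\<And>t. t \<in> T \<Longrightarrow> is_poly A (p t)"
  shows "is_poly A (\<lambda>x. \<Sum>t\<in>T. p t x)"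
proof -
  have "\<exists>D. \<forall>t\<in>T. p t \<in> poly_upto A D"
    by (rule is_poly_common_degree[OF assms(1,2)]) (rule assms(3))
  then obtain D where "\<forall>t\<in>T. p t \<in> poly_upto A D" by (elim exE)
  then have "(\<lambda>x. \<Sum>t\<in>T. p t x) \<in> poly_upto A D" by (intro poly_upto_sum) (rule bspec)
  then show ?thesis unfolding is_poly_def by (rule exI)
qed

lemma is_poly_add:
  assumes "finite A" "is_poly A p" "is_poly A q"
  shows "is_poly A (\<lambda>x. p x + q x)"
proof -
  obtain D D' where D: "p \<in> poly_upto A D" "q \<in> poly_upto A D'"
    using assms(2,3) unfolding is_poly_def by (elim exE)
  have "p \<in> poly_upto A (D + D')" "q \<in> poly_upto A (D + D')"
    using D subsetD[OF poly_upto_mono[OF assms(1) order_refl le_add1]]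
      subsetD[OF poly_upto_mono[OF assms(1) order_refl le_add2]] by simp_all
  from poly_upto_add[OF this] show ?thesis unfolding is_poly_def by (rule exI)
qed

lemma is_poly_uminus:
  assumes "finite A" "is_poly A p"
  shows "is_poly A (\<lambda>x. - p x)"
  using is_poly_mult[OF assms(1) is_poly_const[OF assms(1), of "-1"] assms(2)] by simp

lemma is_poly_diff:
  assumes "finite A" "is_poly A p" "is_poly A q"
  shows "is_poly A (\<lambda>x. p x - q x)"
  using is_poly_add[OF assms(1,2) is_poly_uminus[OF assms(1,3)]] by simp

section \<open>Generic points\<close>

text \<open>A property is generic if it can only fail where one of finitely many nonzero polynomials vanishes.
With a finite family instead of a single polynomial, closure under conjunction is immediate.\<close>

definition generic :: "'a set \<Rightarrow> (('a \<Rightarrow> real) \<Rightarrow> bool) \<Rightarrow> bool" where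
  "generic K P \<longleftrightarrow> (\<exists>\<Z>. finite \<Z> \<and> (\<forall>Z\<in>\<Z>. (\<exists>D. Z \<in> poly_upto K D) \<and> (\<exists>y. Z y \<noteq> 0)) \<and>
      (\<forall>y. (\<forall>Z\<in>\<Z>. Z y \<noteq> 0) \<longrightarrow> P y))"

lemma generic_by_polynomial:
  assumes "Z \<in> poly_upto K D" "Z y0 \<noteq> 0" "\<And>y. Z y \<noteq> 0 \<Longrightarrow> P y"
  shows "generic K P"
  unfolding generic_def using assms by (intro exI[of _ "{Z}"]) auto

lemma generic_imp:
  assumes "generic K P" "\<And>y. P y \<Longrightarrow> Q y"
  shows "generic K Q"
  using assms unfolding generic_def by meson

lemma generic_mono:
  assumes "generic K P" "finite K'" "K \<subseteq> K'"
  shows "generic K' P"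
proof -
  obtain \<Z> where \<Z>: "finite \<Z>" "\<forall>Z\<in>\<Z>. (\<exists>D. Z \<in> poly_upto K D) \<and> (\<exists>y. Z y \<noteq> 0)"
    "\<forall>y. (\<forall>Z\<in>\<Z>. Z y \<noteq> 0) \<longrightarrow> P y"
    using assms(1) unfolding generic_def by blast
  have "(\<exists>D. Z \<in> poly_upto K' D) \<and> (\<exists>y. Z y \<noteq> 0)" if "Z \<in> \<Z>" for Z
    using \<Z>(2) that poly_upto_mono[OF assms(2,3) order_refl] by (meson subsetD)
  then show ?thesis unfolding generic_def using \<Z>(1,3) by (intro exI[of _ \<Z>]) simp
qed

lemma generic_conj:
  assumes "generic K P" "generic K Q"
  shows "generic K (\<lambda>y. P y \<and> Q y)"
proof -
  obtain \<Z> where \<Z>: "finite \<Z>" "\<forall>Z\<in>\<Z>. (\<exists>D. Z \<in> poly_upto K D) \<and> (\<exists>y. Z y \<noteq> 0)"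
    "\<forall>y. (\<forall>Z\<in>\<Z>. Z y \<noteq> 0) \<longrightarrow> P y"
    using assms(1) unfolding generic_def by blast
  obtain \<W> where \<W>: "finite \<W>" "\<forall>Z\<in>\<W>. (\<exists>D. Z \<in> poly_upto K D) \<and> (\<exists>y. Z y \<noteq> 0)"
    "\<forall>y. (\<forall>Z\<in>\<W>. Z y \<noteq> 0) \<longrightarrow> Q y"
    using assms(2) unfolding generic_def by blast
  show ?thesis
    unfolding generic_def ball_Un using \<Z> \<W> by (intro exI[of _ "\<Z> \<union> \<W>"]) (simp add: ball_Un)
qed

lemma generic_ball:
  assumes "finite T" "\<And>t. t \<in> T \<Longrightarrow> generic K (P t)"
  shows "generic K (\<lambda>y. \<forall>t\<in>T. P t y)"
  using assms
proof (induction T rule: finite_induct)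
  case empty
  show ?case unfolding generic_def by (intro exI[of _ "{}"]) simp
next
  case (insert t T)
  then show ?case using generic_conj[of K "P t" "\<lambda>y. \<forall>t\<in>T. P t y"] by simp
qed

text \<open>Starting at a point where the polynomials treated so far do not vanish, move towards a point where
the next one does not vanish. On this line all of them restrict to nonzero polynomials in one
variable, so arbitrarily short moves avoid all their roots.\<close>

lemma nonroot_near:
  assumes "finite K" "finite \<Z>"
    and "\<And>Z. Z \<in> \<Z> \<Longrightarrow> (\<exists>D. Z \<in> poly_upto K D) \<and> (\<exists>y. Z y \<noteq> 0)"
    and "\<epsilon> > 0"
  shows "\<exists>y. (\<forall>k\<in>K. \<bar>y k - y0 k\<bar> < \<epsilon>) \<and> (\<forall>Z\<in>\<Z>. Z y \<noteq> 0)"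
  using assms(2,3)
proof (induction \<Z> rule: finite_induct)
  case empty
  then show ?case using assms(4) by (intro exI[of _ y0]) auto
next
  case (insert Z \<Z>)
  then obtain y where y: "\<forall>k\<in>K. \<bar>y k - y0 k\<bar> < \<epsilon>" "\<forall>Z\<in>\<Z>. Z y \<noteq> 0" by auto
  obtain z where z: "Z z \<noteq> 0" using insert.prems by blast
  let ?l = "\<lambda>t k. y k + t * (z k - y k)"
  have ex: "\<exists>r. \<forall>t. W (?l t) = poly r t" if W: "W \<in> insert Z \<Z>" for W
  proof -
    obtain D where "W \<in> poly_upto K D" using insert.prems[OF W] by blast
    then show ?thesis by (rule poly_upto_on_line[OF assms(1)])
  qed
  define r where "r W = (SOME r. \<forall>t. W (?l t) = poly r t)" for W
  have r: "W (?l t) = poly (r W) t" if "W \<in> insert Z \<Z>" for W t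
    using someI_ex[OF ex[OF that]] unfolding r_def by (rule spec)
  have "r W \<noteq> 0" if "W \<in> insert Z \<Z>" for W
  proof
    assume 0: "r W = 0"
    show False
    proof (cases "W = Z")
      case True
      then show False using r[OF that, of 1] z 0 by simp
    next
      case False
      then show False using r[OF that, of 0] y(2) that 0 by simp
    qed
  qed
  then have fin: "finite (\<Union>W\<in>insert Z \<Z>. {t. poly (r W) t = 0})"
    using insert(1) by (intro finite_UN_I poly_roots_finite) auto
  have "eventually (\<lambda>t. \<forall>k\<in>K. \<bar>?l t k - y0 k\<bar> < \<epsilon>) (at_right 0)"
  proof (rule eventually_ball_finite[OF assms(1)], rule ballI)
    fix k assume k: "k \<in> K"
    have "((\<lambda>t. \<bar>?l t k - y0 k\<bar>) \<longlongrightarrow> \<bar>?l 0 k - y0 k\<bar>) (at_right 0)"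
      by (intro tendsto_intros)
    then show "eventually (\<lambda>t. \<bar>?l t k - y0 k\<bar> < \<epsilon>) (at_right 0)"
      by (rule order_tendstoD(2)) (use y(1) k in simp)
  qed
  then obtain b where b: "b > 0" "\<And>t. 0 < t \<Longrightarrow> t < b \<Longrightarrow> \<forall>k\<in>K. \<bar>?l t k - y0 k\<bar> < \<epsilon>"
    unfolding eventually_at_right_field by blast
  have "infinite {0<..<b}" using b(1) by simp
  then obtain t where t: "t \<in> {0<..<b}" "t \<notin> (\<Union>W\<in>insert Z \<Z>. {t. poly (r W) t = 0})"
    using fin by (meson finite_subset subsetI)
  have "W (?l t) \<noteq> 0" if "W \<in> insert Z \<Z>" for W
    using t(2) that unfolding r[OF that] by blast
  moreover have "\<forall>k\<in>K. \<bar>?l t k - y0 k\<bar> < \<epsilon>" using b(2)[of t] t(1) by simp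
  ultimately show ?case by (intro exI[of _ "?l t"]) blast
qed

lemma generic_exists_near:
  assumes "generic K P" "finite K" "\<epsilon> > 0"
  shows "\<exists>y. (\<forall>k\<in>K. \<bar>y k - y0 k\<bar> < \<epsilon>) \<and> P y"
proof -
  obtain \<Z> where \<Z>: "finite \<Z>" "\<forall>Z\<in>\<Z>. (\<exists>D. Z \<in> poly_upto K D) \<and> (\<exists>y. Z y \<noteq> 0)"
    "\<forall>y. (\<forall>Z\<in>\<Z>. Z y \<noteq> 0) \<longrightarrow> P y"
    using assms(1) unfolding generic_def by blast
  then show ?thesis using nonroot_near[OF assms(2) \<Z>(1) _ assms(3), of y0] by blast
qed

lemma poly_upto_substitute:
  assumes "finite I" "finite K" "p \<in> poly_upto K D'" "\<And>k. k \<in> K \<Longrightarrow> F k \<in> poly_upto I D"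
  shows "(\<lambda>x. p (\<lambda>k. F k x)) \<in> poly_upto I (D * D')"
proof -
  obtain c where c: "\<And>x. p x = (\<Sum>e\<in>exponents K D'. c e * monomial K e x)"
    using assms(3) unfolding poly_upto_def by blast
  have "(\<lambda>x. \<Sum>e\<in>exponents K D'. c e * monomial K e (\<lambda>k. F k x)) \<in> poly_upto I (D * D')"
  proof (intro poly_upto_sum poly_upto_cmult)
    fix e assume "e \<in> exponents K D'"
    then have "D * sum e K \<le> D * D'" by (simp add: exponents_def)
    from subsetD[OF poly_upto_mono[OF assms(1) order_refl this]]
    show "(\<lambda>x. monomial K e (\<lambda>k. F k x)) \<in> poly_upto I (D * D')"
      using poly_upto_monomial_subst[OF assms(1,2,4)] .
  qed
  then show ?thesis unfolding c .
qed

text \<open>If no polynomial of the family vanishes at a point, each stays nonzero as a polynomial in the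
\<open>B\<close>-coordinates after the \<open>A\<close>-coordinates have been frozen at that point. This
allows parameters to be chosen in two rounds, the second depending on the first.\<close>

lemma generic_section:
  assumes "generic (A <+> B) P" "finite A" "finite B" "\<epsilon> > 0"
  shows "\<exists>u. (\<forall>a\<in>A. \<bar>u a - u0 a\<bar> < \<epsilon>) \<and> generic B (\<lambda>v. P (case_sum u v))"
proof -
  obtain \<Z> where \<Z>: "finite \<Z>" "\<forall>Z\<in>\<Z>. (\<exists>D. Z \<in> poly_upto (A <+> B) D) \<and> (\<exists>y. Z y \<noteq> 0)"
    "\<forall>y. (\<forall>Z\<in>\<Z>. Z y \<noteq> 0) \<longrightarrow> P y"
    using assms(1) unfolding generic_def by blast
  have fin: "finite (A <+> B)" using assms by simp
  obtain y where y: "\<forall>k\<in>A <+> B. \<bar>y k - case_sum u0 (\<lambda>_. 0) k\<bar> < \<epsilon>" "\<forall>Z\<in>\<Z>. Z y \<noteq> 0"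
    using nonroot_near[OF fin \<Z>(1) _ assms(4), of "case_sum u0 (\<lambda>_. 0)"] \<Z>(2) by blast
  let ?u = "\<lambda>a. y (Inl a)" and ?s = "\<lambda>Z v. Z (case_sum (\<lambda>a. y (Inl a)) v)"
  have "generic B (\<lambda>v. P (case_sum ?u v))"
    unfolding generic_def
  proof (intro exI[of _ "?s ` \<Z>"] conjI ballI allI impI)
    fix W assume "W \<in> ?s ` \<Z>"
    then obtain Z where Z: "Z \<in> \<Z>" "W = ?s Z" by blast
    obtain D where D: "Z \<in> poly_upto (A <+> B) D" using \<Z>(2) Z by blast
    have eq: "(\<lambda>v. Z (\<lambda>k. (case k of Inl a \<Rightarrow> \<lambda>_. y (Inl a) | Inr b \<Rightarrow> \<lambda>v. v b) v)) = ?s Z"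
      by (intro ext arg_cong[where f = Z]) (auto split: sum.split)
    have "(\<lambda>v. Z (\<lambda>k. (case k of Inl a \<Rightarrow> \<lambda>_. y (Inl a) | Inr b \<Rightarrow> \<lambda>v. v b) v)) \<in> poly_upto B (1 * D)"
    proof (rule poly_upto_substitute[OF assms(3) fin D])
      fix k assume "k \<in> A <+> B"
      then show "(case k of Inl a \<Rightarrow> \<lambda>_. y (Inl a) | Inr b \<Rightarrow> \<lambda>v. v b) \<in> poly_upto B 1"
        using poly_upto_const[OF assms(3)] poly_upto_var[OF assms(3) _ order_refl]
        by (elim PlusE) simp_all
    qed
    then show "\<exists>D. W \<in> poly_upto B D" unfolding eq Z(2) by blast
    have "case_sum ?u (\<lambda>b. y (Inr b)) = y" by (auto simp: fun_eq_iff split: sum.split)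
    then show "\<exists>v. W v \<noteq> 0" using y(2) Z by (intro exI[of _ "\<lambda>b. y (Inr b)"]) simp
  qed (use \<Z> in auto)
  moreover have "\<forall>a\<in>A. \<bar>?u a - u0 a\<bar> < \<epsilon>" using y(1) by force
  ultimately show ?thesis by (intro exI[of _ ?u] conjI)
qed

lemma generic_reindex:
  assumes "generic B P" "finite B" "finite K" "\<And>b. b \<in> B \<Longrightarrow> h b \<in> K" "inj h"
  shows "generic K (\<lambda>y. P (\<lambda>b. y (h b)))"
proof -
  obtain \<Z> where \<Z>: "finite \<Z>" "\<forall>Z\<in>\<Z>. (\<exists>D. Z \<in> poly_upto B D) \<and> (\<exists>y. Z y \<noteq> 0)"
    "\<forall>y. (\<forall>Z\<in>\<Z>. Z y \<noteq> 0) \<longrightarrow> P y"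
    using assms(1) unfolding generic_def by blast
  let ?s = "\<lambda>Z y. Z (\<lambda>b. y (h b))"
  show ?thesis
    unfolding generic_def
  proof (intro exI[of _ "?s ` \<Z>"] conjI ballI allI impI)
    fix W assume "W \<in> ?s ` \<Z>"
    then obtain Z where Z: "Z \<in> \<Z>" "W = ?s Z" by blast
    obtain D where D: "Z \<in> poly_upto B D" using \<Z>(2) Z by blast
    have "?s Z \<in> poly_upto K (1 * D)"
      by (rule poly_upto_substitute[OF assms(3,2) D]) (simp_all add: poly_upto_var assms)
    then show "\<exists>D. W \<in> poly_upto K D" unfolding Z(2) by blast
    obtain v where "Z v \<noteq> 0" using \<Z>(2) Z by blast
    then show "\<exists>y. W y \<noteq> 0"
      unfolding Z(2) using assms(5) by (intro exI[of _ "\<lambda>k. v (inv h k)"]) simp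
  qed (use \<Z> in auto)
qed

section \<open>Images and fibres of polynomial maps\<close>

text \<open>The number of monomials of degree at most \<open>D * t\<close> in \<open>M\<close> variables exceeds that of
degree at most \<open>t\<close> by a factor tending to \<open>D ^ M\<close>. This factor is the Bezout number
that appears in the fibre bound below.\<close>

lemma binomial_growth:
  "(\<lambda>t. real (M + (D * t + q) choose M) / real t ^ M) \<longlonglongrightarrow> real D ^ M / fact M"
proof -
  have eq: "real (M + (D * t + q) choose M) / real t ^ M
      = (\<Prod>i = 0..<M. (real D * real t + (real q + real M - real i)) / real t) / fact M" for t
    unfolding binomial_gbinomial gbinomial_prod_rev
    by (simp add: prod_dividef algebra_simps)
  have "(\<lambda>t. (real D * real t + (real q + real M - real i)) / real t) \<longlonglongrightarrow> real D" for i
  proof -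
    have "(\<lambda>t. real D + (real q + real M - real i) * inverse (real t)) \<longlonglongrightarrow> real D + (real q + real M - real i) * 0"
      by (intro tendsto_intros lim_inverse_n)
    moreover have "eventually (\<lambda>t. real D + (real q + real M - real i) * inverse (real t)
        = (real D * real t + (real q + real M - real i)) / real t) sequentially"
      by (intro eventually_sequentiallyI[of 1]) (simp add: field_simps)
    ultimately show ?thesis by (simp add: Lim_transform_eventually)
  qed
  then have "(\<lambda>t. (\<Prod>i = 0..<M. (real D * real t + (real q + real M - real i)) / real t) / fact M)
      \<longlonglongrightarrow> (\<Prod>i = 0..<M. real D) / fact M"
    by (intro tendsto_intros) auto
  then show ?thesis unfolding eq by simp
qed

text \<open>The polynomials of degree at most \<open>t\<close> in the coordinates \<open>K\<close> form a space of
dimension of order \<open>t ^ card K\<close>, but composition with \<open>G\<close> maps them into a space of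
dimension of order \<open>t ^ card A\<close>. So for large \<open>t\<close> some nonzero polynomial vanishes on
the image of \<open>G\<close>.\<close>

lemma generic_not_in_image:
  assumes "finite A" "finite K" "card A < card K" "\<And>k. k \<in> K \<Longrightarrow> G k \<in> poly_upto A D"
  shows "generic K (\<lambda>y. \<not> (\<exists>x. \<forall>k\<in>K. y k = G k x))"
proof -
  let ?M = "card A" and ?M' = "card K"
  have "(\<lambda>t. real (?M + (D * t + 0) choose ?M) / real t ^ ?M * inverse (real t ^ (?M' - ?M)))
      \<longlonglongrightarrow> real D ^ ?M / fact ?M * 0"
  proof (intro tendsto_mult binomial_growth tendsto_inverse_0_at_top filterlim_pow_at_top)
    show "0 < ?M' - ?M" using assms by simp
    show "filterlim real at_top sequentially" by (rule filterlim_real_sequentially)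
  qed
  moreover have "(\<lambda>t. real (?M' + (1 * t + 0) choose ?M') / real t ^ ?M') \<longlonglongrightarrow> real 1 ^ ?M' / fact ?M'"
    by (rule binomial_growth)
  ultimately have "(\<lambda>t. real (?M' + (1 * t + 0) choose ?M') / real t ^ ?M' -
      real (?M + (D * t + 0) choose ?M) / real t ^ ?M * inverse (real t ^ (?M' - ?M)))
      \<longlonglongrightarrow> real 1 ^ ?M' / fact ?M' - real D ^ ?M / fact ?M * 0"
    by (intro tendsto_diff)
  from order_tendstoD(1)[OF this, of 0]
  have "eventually (\<lambda>t. 0 < real (?M' + (1 * t + 0) choose ?M') / real t ^ ?M' -
      real (?M + (D * t + 0) choose ?M) / real t ^ ?M * inverse (real t ^ (?M' - ?M))) sequentially"
    by simp
  from eventually_conj[OF this eventually_gt_at_top[of 0]]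
  obtain t where t: "t > 0" "0 < real (?M' + t choose ?M') / real t ^ ?M' -
      real (?M + D * t choose ?M) / real t ^ ?M * inverse (real t ^ (?M' - ?M))"
    unfolding eventually_sequentially by auto
  have "real t ^ ?M * real t ^ (?M' - ?M) = real t ^ ?M'"
    using assms(3) by (simp flip: power_add)
  then have "real (?M + D * t choose ?M) / real t ^ ?M * inverse (real t ^ (?M' - ?M))
      = real (?M + D * t choose ?M) / real t ^ ?M'"
    by (metis divide_divide_eq_left divide_inverse)
  then have "?M + D * t choose ?M < ?M' + t choose ?M'"
    using t by (simp add: divide_less_cancel)
  then have lt: "(?M + D * t) choose (D * t) < card (exponents K t)"
    using card_exponents[OF assms(2), of t]
      binomial_symmetric[of ?M "?M + D * t"] binomial_symmetric[of ?M' "?M' + t"] by simp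
  have deg: "(\<lambda>x. monomial K e (\<lambda>k. G k x)) \<in> poly_upto A (D * t)" if "e \<in> exponents K t" for e
  proof -
    have "D * sum e K \<le> D * t" using that by (simp add: exponents_def)
    from subsetD[OF poly_upto_mono[OF assms(1) order_refl this]]
    show ?thesis using poly_upto_monomial_subst[OF assms(1,2,4)] .
  qed
  have "\<exists>c. (\<exists>e\<in>exponents K t. c e \<noteq> 0) \<and>
      (\<forall>x. (\<Sum>e\<in>exponents K t. c e * monomial K e (\<lambda>k. G k x)) = 0)"
    by (rule poly_upto_dependent[OF assms(1) finite_exponents[OF assms(2)] lt]) (rule deg)
  then obtain c where c: "\<exists>e\<in>exponents K t. c e \<noteq> 0"
      "\<forall>x. (\<Sum>e\<in>exponents K t. c e * monomial K e (\<lambda>k. G k x)) = 0"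
    by (elim exE conjE)
  let ?Z = "\<lambda>y. \<Sum>e\<in>exponents K t. c e * monomial K e y"
  have Z: "?Z \<in> poly_upto K t" by (rule poly_uptoI) simp
  obtain y0 where y0: "?Z y0 \<noteq> 0"
    using monomial_independent[OF assms(2), of c t] c(1) by blast
  have avoid: "\<not> (\<exists>x. \<forall>k\<in>K. y k = G k x)" if "?Z y \<noteq> 0" for y
  proof
    assume "\<exists>x. \<forall>k\<in>K. y k = G k x"
    then obtain x where x: "\<forall>k\<in>K. y k = G k x" by blast
    have "monomial K e y = monomial K e (\<lambda>k. G k x)" for e
      using x by (simp add: monomial_def)
    then show False using c(2) that by simp
  qed
  show ?thesis
    by (rule generic_by_polynomial[where Z = "?Z" and ?y0.0 = y0, OF Z y0]) (rule avoid)
qed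

text \<open>The coefficient vectors are taken on the moment curve: two distinct points are confused only if
\<open>t\<close> is a root of a fixed nonzero polynomial of degree at most \<open>M\<close>. The range for
\<open>t\<close> depends only on the number of points, so finitely many forms serve all sets of that size.\<close>

lemma separating_linear_form:
  fixes X :: "('a \<Rightarrow> real) set"
  assumes "finite I" "inj_on \<nu> I" "\<nu> ` I \<subseteq> {..<M}" "finite X"
    and "inj_on (\<lambda>x. restrict x I) X"
  shows "\<exists>t\<le>card X * card X * M. inj_on (\<lambda>x. \<Sum>i\<in>I. real t ^ \<nu> i * x i) X"
proof -
  define R where "R x x' = (\<Sum>i\<in>I. monom (x i - x' i) (\<nu> i))" for x x' :: "'a \<Rightarrow> real"
  have poly_R: "poly (R x x') t = (\<Sum>i\<in>I. t ^ \<nu> i * x i) - (\<Sum>i\<in>I. t ^ \<nu> i * x' i)" for x x' t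
    by (simp add: R_def poly_sum poly_monom algebra_simps sum_subtractf)
  define bad where "bad = (\<Union>(x, x')\<in>{(x, x') \<in> X \<times> X. x \<noteq> x'}. {t. poly (R x x') t = 0})"
  have roots: "finite {t. poly (R x x') t = 0} \<and> card {t. poly (R x x') t = 0} \<le> M"
    if "x \<in> X" "x' \<in> X" "x \<noteq> x'" for x x'
  proof -
    have "restrict x I \<noteq> restrict x' I" using that assms(5) by (auto dest: inj_onD)
    then obtain i where i: "i \<in> I" "x i \<noteq> x' i" by (metis restrict_ext)
    have "coeff (R x x') (\<nu> i) = (\<Sum>j\<in>I. if j = i then x j - x' j else 0)"
      unfolding R_def coeff_sum using i(1) assms(2)
      by (intro sum.cong) (auto dest: inj_onD)
    then have nz: "R x x' \<noteq> 0" using i assms(1) by auto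
    have "degree (R x x') \<le> M"
      unfolding R_def
    proof (rule degree_sum_le[OF assms(1)])
      fix j assume "j \<in> I"
      then have "\<nu> j \<le> M" using assms(3) by (meson imageI lessThan_iff less_imp_le subsetD)
      then show "degree (monom (x j - x' j) (\<nu> j)) \<le> M" by (rule order_trans[OF degree_monom_le])
    qed
    then show ?thesis using poly_roots_finite[OF nz] card_poly_roots_bound[OF nz] by simp
  qed
  let ?Y = "{(x, x') \<in> X \<times> X. x \<noteq> x'}"
  have finY: "finite ?Y" by (rule finite_subset[of _ "X \<times> X"]) (use assms(4) in auto)
  have "finite bad" unfolding bad_def using finY roots by (intro finite_UN_I) auto
  have "card bad \<le> (\<Sum>p\<in>?Y. card (case p of (x, x') \<Rightarrow> {t. poly (R x x') t = 0}))"
    unfolding bad_def by (rule card_UN_le[OF finY])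
  also have "\<dots> \<le> (\<Sum>p\<in>?Y. M)" using roots by (intro sum_mono) auto
  also have "\<dots> \<le> card X * card X * M"
    using card_mono[of "X \<times> X" ?Y] assms(4) by (auto simp: card_cartesian_product)
  finally have "card bad < card (real ` {..card X * card X * M})" by (simp add: card_image)
  then have "\<not> real ` {..card X * card X * M} \<subseteq> bad"
    using card_mono[OF \<open>finite bad\<close>] by (meson not_le)
  then obtain t where t: "t \<le> card X * card X * M" "real t \<notin> bad" by auto
  have "inj_on (\<lambda>x. \<Sum>i\<in>I. real t ^ \<nu> i * x i) X"
  proof (rule inj_onI, rule ccontr)
    fix x x' assume x: "x \<in> X" "x' \<in> X" "(\<Sum>i\<in>I. real t ^ \<nu> i * x i) = (\<Sum>i\<in>I. real t ^ \<nu> i * x' i)" "x \<noteq> x'"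
    then have "poly (R x x') (real t) = 0" by (simp add: poly_R)
    then show False using t(2) x unfolding bad_def by blast
  qed
  then show ?thesis using t(1) by blast
qed

text \<open>A form of Bezout's theorem obtained by counting dimensions. Put \<open>N = D ^ card I\<close>. The
products of a power \<open>l ^ i\<close> with \<open>i \<le> N\<close> and a monomial of degree at most \<open>t\<close> in the
components of \<open>F\<close> have degree at most \<open>D * t + N\<close>. For large \<open>t\<close> there are more of
them than monomials, because \<open>N + 1 > D ^ card I\<close>, so they satisfy a nontrivial relation. On
the fibre over \<open>y\<close> this relation says that the values of \<open>l\<close> are roots of a polynomial of
degree at most \<open>N\<close> whose coefficients are polynomials in \<open>y\<close>. If \<open>l\<close> takes
\<open>N + 1\<close> values there, all coefficients vanish at \<open>y\<close>, and at least one of them is not the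
zero polynomial.\<close>

lemma generic_fibre_separated:
  assumes "finite I" "finite K" "card I = card K" "\<And>k. k \<in> K \<Longrightarrow> F k \<in> poly_upto I D"
    and l: "l \<in> poly_upto I 1"
  shows "generic K (\<lambda>y. \<not> (\<exists>X. card X = Suc (D ^ card I) \<and> inj_on l X \<and> (\<forall>x\<in>X. \<forall>k\<in>K. F k x = y k)))"
proof -
  let ?M = "card I" and ?N = "D ^ card I"
  have "(\<lambda>t. real (Suc ?N) * (real (?M + (1 * t + 0) choose ?M) / real t ^ ?M))
      \<longlonglongrightarrow> real (Suc ?N) * (real 1 ^ ?M / fact ?M)"
    by (intro tendsto_intros binomial_growth)
  from tendsto_diff[OF this binomial_growth[of ?M D ?N]]
  have "(\<lambda>t. real (Suc ?N) * (real (?M + (1 * t + 0) choose ?M) / real t ^ ?M)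
      - real (?M + (D * t + ?N) choose ?M) / real t ^ ?M)
      \<longlonglongrightarrow> real (Suc ?N) * (real 1 ^ ?M / fact ?M) - real D ^ ?M / fact ?M" .
  moreover have "0 < real (Suc ?N) * (real 1 ^ ?M / fact ?M) - real D ^ ?M / fact ?M"
    by (simp add: field_simps)
  ultimately have "eventually (\<lambda>t. 0 < real (Suc ?N) * (real (?M + (1 * t + 0) choose ?M) / real t ^ ?M)
      - real (?M + (D * t + ?N) choose ?M) / real t ^ ?M) sequentially"
    by (rule order_tendstoD(1))
  from eventually_conj[OF this eventually_gt_at_top[of 0]]
  obtain t where t: "t > 0" "0 < real (Suc ?N) * (real (?M + t choose ?M) / real t ^ ?M)
      - real (?M + (D * t + ?N) choose ?M) / real t ^ ?M"
    unfolding eventually_sequentially by auto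
  then have "0 < (real (Suc ?N) * real (?M + t choose ?M) - real (?M + (D * t + ?N) choose ?M)) / real t ^ ?M"
    by (simp only: diff_divide_distrib times_divide_eq_right)
  then have "real (?M + (D * t + ?N) choose ?M) < real (Suc ?N * (?M + t choose ?M))"
    using t(1) unfolding zero_less_divide_iff of_nat_mult by simp
  then have lt0: "?M + (D * t + ?N) choose ?M < Suc ?N * (?M + t choose ?M)"
    unfolding of_nat_less_iff .
  let ?A = "{..?N} \<times> exponents K t"
  have finA: "finite ?A" using finite_exponents[OF assms(2)] by simp
  have "card ?A = Suc ?N * (?M + t choose ?M)"
    using card_exponents[OF assms(2), of t] binomial_symmetric[of ?M "?M + t"] assms(3)
    by (simp add: card_cartesian_product)
  then have lt: "(?M + (D * t + ?N)) choose (D * t + ?N) < card ?A"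
    using lt0 binomial_symmetric[of ?M "?M + (D * t + ?N)"] by simp
  have deg: "(\<lambda>x. l x ^ fst a * monomial K (snd a) (\<lambda>k. F k x)) \<in> poly_upto I (D * t + ?N)"
    if "a \<in> ?A" for a
  proof -
    have "1 * fst a + D * sum (snd a) K \<le> D * t + ?N"
    proof -
      have "fst a \<le> ?N" "sum (snd a) K \<le> t" using that by (auto simp: exponents_def)
      then show ?thesis using mult_le_mono2[of "sum (snd a) K" t D] by linarith
    qed
    from subsetD[OF poly_upto_mono[OF assms(1) order_refl this]]
    show ?thesis
      using poly_upto_mult[OF assms(1) poly_upto_power[OF assms(1) l]
          poly_upto_monomial_subst[OF assms(1,2,4)]] .
  qed
  have "\<exists>c. (\<exists>a\<in>?A. c a \<noteq> 0) \<and>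
      (\<forall>x. (\<Sum>a\<in>?A. c a * (l x ^ fst a * monomial K (snd a) (\<lambda>k. F k x))) = 0)"
    by (rule poly_upto_dependent[OF assms(1) finA lt]) (rule deg)
  then obtain c where c0: "\<exists>a\<in>?A. c a \<noteq> 0"
    and c: "\<forall>x. (\<Sum>a\<in>?A. c a * (l x ^ fst a * monomial K (snd a) (\<lambda>k. F k x))) = 0"
    by (elim exE conjE)
  from c0 obtain i e where ie: "i \<le> ?N" "e \<in> exponents K t" "c (i, e) \<noteq> 0" by auto
  let ?P = "\<lambda>i y. \<Sum>e\<in>exponents K t. c (i, e) * monomial K e y"
  have Z: "?P i \<in> poly_upto K t" by (rule poly_uptoI) simp
  obtain y0 where y0: "?P i y0 \<noteq> 0"
    using monomial_independent[OF assms(2), of "\<lambda>e. c (i, e)" t] ie(2,3) by blast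
  have avoid: "\<not> (\<exists>X. card X = Suc ?N \<and> inj_on l X \<and> (\<forall>x\<in>X. \<forall>k\<in>K. F k x = y k))"
    if "?P i y \<noteq> 0" for y
  proof
    assume "\<exists>X. card X = Suc ?N \<and> inj_on l X \<and> (\<forall>x\<in>X. \<forall>k\<in>K. F k x = y k)"
    then obtain X where X: "card X = Suc ?N" "inj_on l X" "\<forall>x\<in>X. \<forall>k\<in>K. F k x = y k" by blast
    have root: "(\<Sum>j\<le>?N. ?P j y * l x ^ j) = 0" if "x \<in> X" for x
    proof -
      have "monomial K e (\<lambda>k. F k x) = monomial K e y" for e
        using X(3) that by (simp add: monomial_def)
      then have "(\<Sum>a\<in>?A. c a * (l x ^ fst a * monomial K (snd a) y)) = 0"
        using spec[OF c, of x] by simp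
      then have "(\<Sum>j\<le>?N. \<Sum>e\<in>exponents K t. c (j, e) * (l x ^ j * monomial K e y)) = 0"
        by (simp add: sum.cartesian_product case_prod_beta)
      then show ?thesis by (simp add: sum_distrib_left sum_distrib_right mult_ac)
    qed
    have "\<exists>j\<le>?N. ?P j y \<noteq> 0" using that ie(1) by blast
    from polyfun_rootbound[of ?N "\<lambda>j. ?P j y"] this
    have "finite {z. (\<Sum>j\<le>?N. ?P j y * z ^ j) = 0}" "card {z. (\<Sum>j\<le>?N. ?P j y * z ^ j) = 0} \<le> ?N"
      using that ie(1) by auto
    moreover have "l ` X \<subseteq> {z. (\<Sum>j\<le>?N. ?P j y * z ^ j) = 0}" using root by blast
    ultimately have "card (l ` X) \<le> ?N" using card_mono by (meson order_trans)
    then show False using X(1,2) by (simp add: card_image)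
  qed
  show ?thesis
    by (rule generic_by_polynomial[where Z = "?P i" and ?y0.0 = y0, OF Z y0]) (rule avoid)
qed

text \<open>Which linear form separates the points of a fibre depends on the fibre, but it can be taken from a
fixed finite list, and a finite conjunction of generic properties is generic.\<close>

lemma generic_fibre_card:
  assumes "finite I" "finite K" "card I = card K" "\<And>k. k \<in> K \<Longrightarrow> F k \<in> poly_upto I D"
  shows "generic K (\<lambda>y. \<forall>X. finite X \<longrightarrow> inj_on (\<lambda>x. restrict x I) X \<longrightarrow>
    (\<forall>x\<in>X. \<forall>k\<in>K. F k x = y k) \<longrightarrow> card X \<le> D ^ card I)"
proof -
  obtain \<nu> where \<nu>: "bij_betw \<nu> I {..<card I}"
    using ex_bij_betw_finite_nat[OF assms(1)] atLeast0LessThan by auto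
  let ?l = "\<lambda>t x. \<Sum>i\<in>I. real t ^ \<nu> i * x i"
  let ?B = "Suc (D ^ card I) * Suc (D ^ card I) * card I"
  have l: "?l t \<in> poly_upto I 1" for t
    by (intro poly_upto_sum poly_upto_cmult poly_upto_var assms) auto
  have "generic K (\<lambda>y. \<forall>t\<in>{..?B}. \<not> (\<exists>X. card X = Suc (D ^ card I) \<and> inj_on (?l t) X \<and>
      (\<forall>x\<in>X. \<forall>k\<in>K. F k x = y k)))"
    by (intro generic_ball generic_fibre_separated assms l) simp
  then show ?thesis
  proof (rule generic_imp)
    fix y
    assume none: "\<forall>t\<in>{..?B}. \<not> (\<exists>X. card X = Suc (D ^ card I) \<and> inj_on (?l t) X \<and>
        (\<forall>x\<in>X. \<forall>k\<in>K. F k x = y k))"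
    have False if X: "finite X" "inj_on (\<lambda>x. restrict x I) X" "\<forall>x\<in>X. \<forall>k\<in>K. F k x = y k"
      and large: "\<not> card X \<le> D ^ card I" for X
    proof -
      from large obtain X' where X': "X' \<subseteq> X" "card X' = Suc (D ^ card I)"
        using obtain_subset_with_card_n[of "Suc (D ^ card I)" X] by auto
      have "finite X'" "inj_on (\<lambda>x. restrict x I) X'"
        using finite_subset[OF X'(1) X(1)] inj_on_subset[OF X(2) X'(1)] by auto
      from separating_linear_form[OF assms(1) bij_betw_imp_inj_on[OF \<nu>]
          eq_refl[OF bij_betw_imp_surj_on[OF \<nu>]] this, unfolded X'(2)]
      obtain t where "t \<le> ?B" "inj_on (?l t) X'" by (elim exE conjE)
      then show False using none X' X(3) by blast
    qed
    then show "\<forall>X. finite X \<longrightarrow> inj_on (\<lambda>x. restrict x I) X \<longrightarrow>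
      (\<forall>x\<in>X. \<forall>k\<in>K. F k x = y k) \<longrightarrow> card X \<le> D ^ card I" by blast
  qed
qed

section \<open>Quadratic constraints and nearest points\<close>

text \<open>Quadratic polynomials without constant term. Their levels are kept apart, so that a constraint
is a comparison of \<open>quad I Q b x\<close> with a threshold \<open>c\<close>.\<close>

definition quad :: "'i set \<Rightarrow> ('i \<Rightarrow> 'i \<Rightarrow> real) \<Rightarrow> ('i \<Rightarrow> real) \<Rightarrow> ('i \<Rightarrow> real) \<Rightarrow> real" where
  "quad I Q b x = (\<Sum>i\<in>I. \<Sum>l\<in>I. Q i l * x i * x l) + (\<Sum>i\<in>I. b i * x i)"

definition quad_grad :: "'i set \<Rightarrow> ('i \<Rightarrow> 'i \<Rightarrow> real) \<Rightarrow> ('i \<Rightarrow> real) \<Rightarrow> ('i \<Rightarrow> real) \<Rightarrow> 'i \<Rightarrow> real" where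
  "quad_grad I Q b x i = (\<Sum>l\<in>I. (Q i l + Q l i) * x l) + b i"

lemma quad_on_line:
  "quad I Q b (\<lambda>i. x i + t * v i) = quad I Q b x + t * (\<Sum>i\<in>I. quad_grad I Q b x i * v i)
     + t\<^sup>2 * (\<Sum>i\<in>I. \<Sum>l\<in>I. Q i l * v i * v l)"
  by (simp add: quad_def quad_grad_def algebra_simps sum.distrib sum_distrib_left
      sum_distrib_right power2_eq_square) (rule sum.swap)

lemma continuous_on_quad: "continuous_on UNIV (quad I Q b)"
  unfolding quad_def[abs_def] by (intro continuous_intros continuous_on_product_coordinates)

lemma quad_cong: "(\<And>i. i \<in> I \<Longrightarrow> x i = y i) \<Longrightarrow> quad I Q b x = quad I Q b y"
  unfolding quad_def by (intro arg_cong2[where f = "(+)"] sum.cong) auto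

text \<open>The linear system with independent rows \<open>u k\<close> is solvable for every right-hand side. The
induction step eliminates a coordinate \<open>i0\<close> on which the new row is nonzero and then
satisfies the new equation by changing this coordinate alone.\<close>

lemma dual_vector:
  fixes u :: "'k \<Rightarrow> 'i \<Rightarrow> real"
  assumes "finite K" "finite I"
    and "\<And>\<alpha>. (\<And>i. i \<in> I \<Longrightarrow> (\<Sum>k\<in>K. \<alpha> k * u k i) = 0) \<Longrightarrow> (\<forall>k\<in>K. \<alpha> k = 0)"
  shows "\<exists>v. \<forall>k\<in>K. (\<Sum>i\<in>I. u k i * v i) = r k"
  using assms(1,3)
proof (induction K arbitrary: u r rule: finite_induct)
  case empty
  then show ?case by simp
next
  case (insert k0 K)
  have "\<exists>i\<in>I. u k0 i \<noteq> 0"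
  proof (rule ccontr)
    assume "\<not> (\<exists>i\<in>I. u k0 i \<noteq> 0)"
    then have "\<forall>k\<in>insert k0 K. (if k = k0 then 1 else (0::real)) = 0"
      using insert(1,2) by (intro insert.prems) (auto intro: sum.neutral)
    then show False by simp
  qed
  then obtain i0 where i0: "i0 \<in> I" "u k0 i0 \<noteq> 0" by blast
  define q where "q k = u k i0 / u k0 i0" for k
  define u' where "u' k i = u k i - q k * u k0 i" for k i
  have "\<exists>v. \<forall>k\<in>K. (\<Sum>i\<in>I. u' k i * v i) = r k - q k * r k0"
  proof (rule insert.IH)
    fix \<alpha> assume *: "\<And>i. i \<in> I \<Longrightarrow> (\<Sum>k\<in>K. \<alpha> k * u' k i) = 0"
    let ?\<mu> = "\<lambda>k. if k = k0 then - (\<Sum>k\<in>K. \<alpha> k * q k) else \<alpha> k"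
    have "(\<Sum>k\<in>insert k0 K. ?\<mu> k * u k i) = (\<Sum>k\<in>K. \<alpha> k * u' k i)" for i
    proof -
      have "(\<Sum>k\<in>K. ?\<mu> k * u k i) = (\<Sum>k\<in>K. \<alpha> k * u k i)"
        using insert(2) by (intro sum.cong) auto
      then show ?thesis
        using insert(1,2) by (simp add: u'_def algebra_simps sum_subtractf sum_distrib_left)
    qed
    then have "\<forall>k\<in>insert k0 K. ?\<mu> k = 0" using * by (intro insert.prems) auto
    then have "?\<mu> k = 0" if "k \<in> K" for k using that by blast
    then show "\<forall>k\<in>K. \<alpha> k = 0" using insert(2) by (metis (full_types))
  qed
  then obtain v where v: "\<And>k. k \<in> K \<Longrightarrow> (\<Sum>i\<in>I. u' k i * v i) = r k - q k * r k0" by blast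
  define s where "s = (r k0 - (\<Sum>i\<in>I. u k0 i * v i)) / u k0 i0"
  have upd: "(\<Sum>i\<in>I. w i * (v(i0 := v i0 + s)) i) = (\<Sum>i\<in>I. w i * v i) + w i0 * s" for w
    using assms(2) i0(1) by (simp add: sum.remove[of I i0] algebra_simps)
  have k0: "(\<Sum>i\<in>I. u k0 i * (v(i0 := v i0 + s)) i) = r k0"
    unfolding upd using i0(2) by (simp add: s_def)
  have "(\<Sum>i\<in>I. u k i * (v(i0 := v i0 + s)) i) = r k" if "k \<in> K" for k
  proof -
    have "u' k i0 = 0" using i0(2) by (simp add: u'_def q_def)
    then have "(\<Sum>i\<in>I. u' k i * (v(i0 := v i0 + s)) i) = r k - q k * r k0"
      unfolding upd using v[OF that] by simp
    moreover have "(\<Sum>i\<in>I. u' k i * (v(i0 := v i0 + s)) i)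
        = (\<Sum>i\<in>I. u k i * (v(i0 := v i0 + s)) i) - q k * (\<Sum>i\<in>I. u k0 i * (v(i0 := v i0 + s)) i)"
      by (simp only: u'_def left_diff_distrib sum_subtractf sum_distrib_left mult.assoc)
    ultimately show ?thesis using k0 by simp
  qed
  then show ?case using k0 by (intro exI[of _ "v(i0 := v i0 + s)"]) auto
qed

text \<open>Only the part of \<open>W\<close> inside a box around \<open>a\<close> matters, and boxes in finitely many
coordinates are compact in the product topology.\<close>

lemma nearest_point_exists:
  fixes W :: "('i \<Rightarrow> real) set"
  assumes "finite I" "closed W" "w \<in> W" "\<forall>i. i \<notin> I \<longrightarrow> w i = 0"
  shows "\<exists>x\<in>W. (\<forall>i. i \<notin> I \<longrightarrow> x i = 0) \<and>
    (\<forall>x'\<in>W. (\<forall>i. i \<notin> I \<longrightarrow> x' i = 0) \<longrightarrow> (\<Sum>i\<in>I. (x i - a i)\<^sup>2) \<le> (\<Sum>i\<in>I. (x' i - a i)\<^sup>2))"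
proof -
  let ?d = "\<lambda>x. \<Sum>i\<in>I. (x i - a i)\<^sup>2"
  define R where "R = sqrt (?d w)"
  let ?C = "\<lambda>i. if i \<in> I then {a i - R..a i + R} else {0}"
  have box: "x \<in> PiE UNIV ?C" if "?d x \<le> ?d w" "\<forall>i. i \<notin> I \<longrightarrow> x i = 0" for x
  proof -
    have "x i \<in> {a i - R..a i + R}" if "i \<in> I" for i
    proof -
      have "(x i - a i)\<^sup>2 \<le> ?d x"
        using assms(1) that by (intro member_le_sum[where f = "\<lambda>i. (x i - a i)\<^sup>2"]) auto
      then have "\<bar>x i - a i\<bar> \<le> R"
        unfolding R_def using \<open>?d x \<le> ?d w\<close> by (intro real_le_rsqrt) auto
      then show ?thesis by auto
    qed
    then show ?thesis using that(2) by auto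
  qed
  have "compact (PiE UNIV ?C)"
    using compactin_PiE[of "\<lambda>_. euclidean" UNIV ?C]
    by (auto simp: euclidean_product_topology compactin_euclidean_iff)
  then have cpt: "compact (PiE UNIV ?C \<inter> W)" using assms(2) by (rule compact_Int_closed)
  have ne: "PiE UNIV ?C \<inter> W \<noteq> {}" using box[OF order_refl assms(4)] assms(3) by blast
  have "continuous_on (PiE UNIV ?C \<inter> W) ?d"
    by (rule continuous_on_subset[OF _ subset_UNIV])
       (intro continuous_intros continuous_on_product_coordinates)
  from continuous_attains_inf[OF cpt ne this]
  obtain x where x: "x \<in> PiE UNIV ?C \<inter> W" "\<forall>x'\<in>PiE UNIV ?C \<inter> W. ?d x \<le> ?d x'"
    by (elim bexE)
  have "\<forall>i. i \<notin> I \<longrightarrow> x i = 0" using x(1) by (auto simp: PiE_def Pi_def split: if_splits)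
  moreover have "?d x \<le> ?d x'" if x': "x' \<in> W" "\<forall>i. i \<notin> I \<longrightarrow> x' i = 0" for x'
  proof (cases "?d x' \<le> ?d w")
    case True
    then show ?thesis using box[OF True x'(2)] x(2) x'(1) by blast
  next
    case False
    have "?d x \<le> ?d w" using box[OF order_refl assms(4)] x(2) assms(3) by blast
    then show ?thesis using False by linarith
  qed
  ultimately show ?thesis using x(1) by blast
qed

lemma eventually_quadratic_pos:
  fixes A B C :: real
  assumes "A > 0 \<or> A = 0 \<and> B > 0"
  shows "eventually (\<lambda>t. A + t * B + t\<^sup>2 * C > 0) (at_right 0)"
  using assms
proof
  assume A: "A > 0"
  have "((\<lambda>t. A + t * B + t\<^sup>2 * C) \<longlongrightarrow> A + 0 * B + 0\<^sup>2 * C) (at_right 0)"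
    by (intro tendsto_intros)
  then show ?thesis by (rule order_tendstoD(1)) (use A in simp)
next
  assume AB: "A = 0 \<and> B > 0"
  have "((\<lambda>t. B + t * C) \<longlongrightarrow> B + 0 * C) (at_right 0)"
    by (intro tendsto_intros)
  then have "eventually (\<lambda>t. B + t * C > 0) (at_right 0)"
    by (rule order_tendstoD(1)) (use AB in simp)
  moreover have "eventually (\<lambda>t::real. t > 0) (at_right 0)"
    by (rule eventually_at_right_less)
  ultimately show ?thesis
  proof eventually_elim
    case (elim t)
    then have "t * (B + t * C) > 0" by simp
    then show ?case using AB by (simp add: algebra_simps power2_eq_square)
  qed
qed

text \<open>The Lagrange multiplier rule for inequalities. If \<open>x - a\<close> were not a combination of the
independent gradients of the active constraints, these vectors would be independent together, and
there would be a direction that increases the slack of every active constraint and decreases the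
distance to \<open>a\<close>, all to first order. A short step in this direction contradicts the
minimality of \<open>x\<close>.\<close>

lemma nearest_point_dependent:
  fixes a :: "'i \<Rightarrow> real" and \<sigma> :: "'j \<Rightarrow> real"
  assumes fin: "finite I" "finite S"
    and \<sigma>: "\<And>j. j \<in> S \<Longrightarrow> \<sigma> j = 1 \<or> \<sigma> j = -1"
    and feas: "\<And>j. j \<in> S \<Longrightarrow> \<sigma> j * (quad I (Q j) (b j) x - c j) \<ge> 0" "\<forall>i. i \<notin> I \<longrightarrow> x i = 0"
    and nearest: "\<And>x'. (\<And>j. j \<in> S \<Longrightarrow> \<sigma> j * (quad I (Q j) (b j) x' - c j) \<ge> 0) \<Longrightarrow>
      \<forall>i. i \<notin> I \<longrightarrow> x' i = 0 \<Longrightarrow> (\<Sum>i\<in>I. (x i - a i)\<^sup>2) \<le> (\<Sum>i\<in>I. (x' i - a i)\<^sup>2)"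
    and indep: "\<And>\<alpha>. (\<And>i. i \<in> I \<Longrightarrow>
        (\<Sum>j\<in>{j\<in>S. quad I (Q j) (b j) x = c j}. \<alpha> j * quad_grad I (Q j) (b j) x i) = 0) \<Longrightarrow>
        \<forall>j\<in>{j\<in>S. quad I (Q j) (b j) x = c j}. \<alpha> j = 0"
  shows "\<exists>\<alpha>. \<forall>i\<in>I. x i - a i
    = (\<Sum>j\<in>{j\<in>S. quad I (Q j) (b j) x = c j}. \<alpha> j * quad_grad I (Q j) (b j) x i)"
proof (rule ccontr)
  let ?J = "{j\<in>S. quad I (Q j) (b j) x = c j}"
  let ?q = "\<lambda>j. quad I (Q j) (b j)" and ?g = "\<lambda>j. quad_grad I (Q j) (b j) x"
  assume no: "\<not> (\<exists>\<alpha>. \<forall>i\<in>I. x i - a i = (\<Sum>j\<in>?J. \<alpha> j * ?g j i))"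
  have finJ: "finite ?J" using fin by simp
  let ?u = "case_option (\<lambda>i. x i - a i) (\<lambda>j. ?g j)"
  have sum_opt: "(\<Sum>k\<in>insert None (Some ` ?J). h k) = h None + (\<Sum>j\<in>?J. h (Some j))"
    for h :: "'j option \<Rightarrow> real"
    using finJ by (simp add: sum.reindex)
  have "\<exists>v. \<forall>k\<in>insert None (Some ` ?J). (\<Sum>i\<in>I. ?u k i * v i) = case_option (-1) \<sigma> k"
  proof (rule dual_vector)
    fix \<alpha> assume *: "\<And>i. i \<in> I \<Longrightarrow> (\<Sum>k\<in>insert None (Some ` ?J). \<alpha> k * ?u k i) = 0"
    then have eq: "\<And>i. i \<in> I \<Longrightarrow> \<alpha> None * (x i - a i) + (\<Sum>j\<in>?J. \<alpha> (Some j) * ?g j i) = 0"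
      unfolding sum_opt by simp
    have "\<alpha> None = 0"
    proof (rule ccontr)
      assume nz: "\<alpha> None \<noteq> 0"
      have "\<forall>i\<in>I. x i - a i = (\<Sum>j\<in>?J. (- \<alpha> (Some j) / \<alpha> None) * ?g j i)"
      proof
        fix i assume "i \<in> I"
        have "(\<Sum>j\<in>?J. (- \<alpha> (Some j) / \<alpha> None) * ?g j i) = - (\<Sum>j\<in>?J. \<alpha> (Some j) * ?g j i) / \<alpha> None"
          by (simp add: sum_divide_distrib sum_negf)
        also have "\<dots> = x i - a i" using eq[OF \<open>i \<in> I\<close>] nz by (simp add: field_simps)
        finally show "x i - a i = (\<Sum>j\<in>?J. (- \<alpha> (Some j) / \<alpha> None) * ?g j i)" ..
      qed
      then show False using no by (auto dest!: spec[of _ "\<lambda>j. - \<alpha> (Some j) / \<alpha> None"])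
    qed
    moreover from this have "\<forall>j\<in>?J. \<alpha> (Some j) = 0" using eq by (intro indep) simp
    ultimately show "\<forall>k\<in>insert None (Some ` ?J). \<alpha> k = 0" by simp
  qed (use finJ fin in auto)
  then obtain v where v: "(\<Sum>i\<in>I. (x i - a i) * v i) = -1"
    "\<And>j. j \<in> ?J \<Longrightarrow> (\<Sum>i\<in>I. ?g j i * v i) = \<sigma> j"
    by auto
  \<comment> \<open>Admissible points vanish outside \<open>I\<close>, so the direction is cut off there.\<close>
  let ?v = "\<lambda>i. if i \<in> I then v i else 0"
  let ?y = "\<lambda>t i. x i + t * ?v i"
  have "eventually (\<lambda>t. \<forall>j\<in>S. \<sigma> j * (?q j (?y t) - c j) > 0) (at_right 0)"
  proof (rule eventually_ball_finite[OF fin(2)], rule ballI)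
    fix j assume j: "j \<in> S"
    let ?A = "\<sigma> j * (?q j x - c j)" and ?B = "\<sigma> j * (\<Sum>i\<in>I. ?g j i * ?v i)"
      and ?C = "\<sigma> j * (\<Sum>i\<in>I. \<Sum>l\<in>I. Q j i l * ?v i * ?v l)"
    have "?A > 0 \<or> ?A = 0 \<and> ?B > 0"
    proof (cases "j \<in> ?J")
      case True
      have "?B = \<sigma> j * \<sigma> j" using v(2)[OF True] by (simp cong: sum.cong)
      then show ?thesis using True \<sigma>[OF j] by auto
    next
      case False
      then have "?A \<noteq> 0" using \<sigma>[OF j] j by auto
      then have "?A > 0" using feas(1)[OF j] by linarith
      then show ?thesis ..
    qed
    from eventually_quadratic_pos[OF this, of ?C]
    show "eventually (\<lambda>t. \<sigma> j * (?q j (?y t) - c j) > 0) (at_right 0)"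
      unfolding quad_on_line by (simp add: algebra_simps)
  qed
  moreover have "eventually (\<lambda>t. 0 + t * 2 + t\<^sup>2 * (- (\<Sum>i\<in>I. (v i)\<^sup>2)) > 0) (at_right 0)"
    by (rule eventually_quadratic_pos) simp
  ultimately have "eventually (\<lambda>t. (\<forall>j\<in>S. \<sigma> j * (?q j (?y t) - c j) > 0) \<and>
      0 + t * 2 + t\<^sup>2 * (- (\<Sum>i\<in>I. (v i)\<^sup>2)) > 0) (at_right (0::real))"
    by (rule eventually_conj)
  from eventually_happens[OF this]
  obtain t :: real where t: "\<forall>j\<in>S. \<sigma> j * (?q j (?y t) - c j) > 0"
    "0 + t * 2 + t\<^sup>2 * (- (\<Sum>i\<in>I. (v i)\<^sup>2)) > 0" by auto
  have "(\<Sum>i\<in>I. (?y t i - a i)\<^sup>2) = (\<Sum>i\<in>I. (x i - a i)\<^sup>2 + 2 * t * ((x i - a i) * v i) + t\<^sup>2 * (v i)\<^sup>2)"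
    by (intro sum.cong) (auto simp: power2_eq_square algebra_simps)
  also have "\<dots> = (\<Sum>i\<in>I. (x i - a i)\<^sup>2) + 2 * t * (\<Sum>i\<in>I. (x i - a i) * v i) + t\<^sup>2 * (\<Sum>i\<in>I. (v i)\<^sup>2)"
    by (simp only: sum.distrib sum_distrib_left)
  also have "\<dots> < (\<Sum>i\<in>I. (x i - a i)\<^sup>2)" using t(2) unfolding v(1) by simp
  finally have "(\<Sum>i\<in>I. (?y t i - a i)\<^sup>2) < (\<Sum>i\<in>I. (x i - a i)\<^sup>2)" .
  moreover have "(\<Sum>i\<in>I. (x i - a i)\<^sup>2) \<le> (\<Sum>i\<in>I. (?y t i - a i)\<^sup>2)"
    using t(1) feas(2) by (intro nearest) (auto intro: less_imp_le)
  ultimately show False by linarith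
qed

section \<open>Active constraints in general position\<close>

lemma is_poly_quad:
  assumes "finite A" "finite I" "\<And>i. i \<in> I \<Longrightarrow> is_poly A (X i)" "\<And>i. i \<in> I \<Longrightarrow> is_poly A (B i)"
  shows "is_poly A (\<lambda>z. quad I Q (\<lambda>i. B i z) (\<lambda>i. X i z))"
  unfolding quad_def by (intro is_poly_add is_poly_sum is_poly_mult is_poly_const assms)

lemma is_poly_quad_grad:
  assumes "finite A" "finite I" "\<And>i. i \<in> I \<Longrightarrow> is_poly A (X i)" "is_poly A (B i)"
  shows "is_poly A (\<lambda>z. quad_grad I Q (\<lambda>i. B i z) (\<lambda>i. X i z) i)"
  unfolding quad_grad_def by (intro is_poly_add is_poly_sum is_poly_mult is_poly_const assms)

definition grads_independent ::
  "'i set \<Rightarrow> ('j \<Rightarrow> 'i \<Rightarrow> 'i \<Rightarrow> real) \<Rightarrow> ('j \<Rightarrow> 'i \<Rightarrow> real) \<Rightarrow> 'j set \<Rightarrow> ('i \<Rightarrow> real) \<Rightarrow> bool" where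
  "grads_independent I Q b T x \<longleftrightarrow>
    (\<forall>\<alpha>. (\<forall>i\<in>I. (\<Sum>j\<in>T. \<alpha> j * quad_grad I (Q j) (b j) x i) = 0) \<longrightarrow> (\<forall>j\<in>T. \<alpha> j = 0))"

text \<open>A parameter count in place of Sard's theorem. Suppose that the gradients at \<open>x\<close> satisfy a
relation whose coefficient at \<open>j1\<close> is \<open>1\<close>. Then the linear part \<open>b j1\<close> is a
polynomial in \<open>x\<close>, the other coefficients and the other linear parts, and the levels of all
constraints at \<open>x\<close> are polynomials in the same data. The degenerate parameters thus form the
image of a polynomial map defined on one dimension less than there are parameters.\<close>

lemma generic_no_relation:
  fixes Q :: "'j \<Rightarrow> 'i \<Rightarrow> 'i \<Rightarrow> real"
  assumes fin: "finite I" "finite T" and j1: "j1 \<in> T"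
  shows "generic ((T \<times> I) <+> T) (\<lambda>y. \<not> (\<exists>x \<alpha>. \<alpha> j1 = 1 \<and>
      (\<forall>i\<in>I. (\<Sum>j\<in>T. \<alpha> j * quad_grad I (Q j) (\<lambda>i. y (Inl (j, i))) x i) = 0) \<and>
      (\<forall>j\<in>T. quad I (Q j) (\<lambda>i. y (Inl (j, i))) x = y (Inr j))))"
proof -
  let ?T = "T - {j1}"
  let ?A = "I <+> (?T <+> ?T \<times> I)" and ?K = "(T \<times> I) <+> T"
  define x where "x z = (\<lambda>i. z (Inl i))" for z :: "'i + 'j + ('j \<times> 'i) \<Rightarrow> real"
  define \<alpha> where "\<alpha> z = (\<lambda>j. z (Inr (Inl j)))" for z :: "'i + 'j + ('j \<times> 'i) \<Rightarrow> real"
  define b where "b j i = (\<lambda>z :: 'i + 'j + ('j \<times> 'i) \<Rightarrow> real. if j = j1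
      then - quad_grad I (Q j1) (\<lambda>_. 0) (x z) i
        - (\<Sum>j\<in>?T. \<alpha> z j * quad_grad I (Q j) (\<lambda>i. z (Inr (Inr (j, i)))) (x z) i)
      else z (Inr (Inr (j, i))))" for j i
  define G where "G = case_sum (\<lambda>(j, i). b j i) (\<lambda>j z. quad I (Q j) (\<lambda>i. b j i z) (x z))"
  have finA: "finite ?A" and finK: "finite ?K" using fin by auto
  have "card T = Suc (card ?T)" using fin(2) j1 by (rule card.remove)
  then have card: "card ?A < card ?K"
    using fin by (simp add: card_Plus card_cartesian_product)
  have px: "is_poly ?A (\<lambda>z. x z i)" if "i \<in> I" for i
    unfolding x_def using that finA by (intro is_poly_var) auto
  have p\<alpha>: "is_poly ?A (\<lambda>z. \<alpha> z j)" if "j \<in> ?T" for j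
    unfolding \<alpha>_def using that finA by (intro is_poly_var) auto
  have pb': "is_poly ?A (\<lambda>z. z (Inr (Inr (j, i))))" if "j \<in> ?T" "i \<in> I" for i j
    using that finA by (intro is_poly_var) auto
  have pb: "is_poly ?A (b j i)" if "j \<in> T" "i \<in> I" for i j
  proof (cases "j = j1")
    case True
    show ?thesis
      unfolding b_def True if_P[OF refl]
      by (intro is_poly_diff is_poly_uminus is_poly_sum is_poly_mult is_poly_quad_grad
          is_poly_const finA fin px p\<alpha> pb' finite_Diff that(2))
  next
    case False
    then show ?thesis unfolding b_def using pb' that by simp
  qed
  have "is_poly ?A (G k)" if "k \<in> ?K" for k
    using that
  proof (elim PlusE)
    fix p assume "p \<in> T \<times> I" "k = Inl p"
    then show ?thesis using pb by (auto simp: G_def)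
  next
    fix j assume j: "j \<in> T" "k = Inr j"
    show ?thesis unfolding G_def j(2) sum.case by (intro is_poly_quad finA fin px pb j(1))
  qed
  then obtain D where D: "\<forall>k\<in>?K. G k \<in> poly_upto ?A D"
    using is_poly_common_degree[OF finA finK] by blast
  have gen: "generic ?K (\<lambda>y. \<not> (\<exists>z. \<forall>k\<in>?K. y k = G k z))"
    by (rule generic_not_in_image[OF finA finK card]) (rule bspec[OF D])
  show ?thesis
  proof (rule generic_imp[OF gen])
    fix y :: "('j \<times> 'i) + 'j \<Rightarrow> real" assume no: "\<not> (\<exists>z. \<forall>k\<in>?K. y k = G k z)"
    let ?b = "\<lambda>j i. y (Inl (j, i))"
    show "\<not> (\<exists>x \<alpha>. \<alpha> j1 = 1 \<and>
      (\<forall>i\<in>I. (\<Sum>j\<in>T. \<alpha> j * quad_grad I (Q j) (?b j) x i) = 0) \<and>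
      (\<forall>j\<in>T. quad I (Q j) (?b j) x = y (Inr j)))"
    proof
      assume "\<exists>x \<alpha>. \<alpha> j1 = 1 \<and>
        (\<forall>i\<in>I. (\<Sum>j\<in>T. \<alpha> j * quad_grad I (Q j) (?b j) x i) = 0) \<and>
        (\<forall>j\<in>T. quad I (Q j) (?b j) x = y (Inr j))"
      then obtain x' \<alpha>' where *: "\<alpha>' j1 = 1"
        "\<forall>i\<in>I. (\<Sum>j\<in>T. \<alpha>' j * quad_grad I (Q j) (?b j) x' i) = 0"
        "\<forall>j\<in>T. quad I (Q j) (?b j) x' = y (Inr j)"
        by (elim exE conjE)
      define z where "z = case_sum x' (case_sum \<alpha>' (\<lambda>p. y (Inl p)))"
      have xz: "x z = x'" and \<alpha>z: "\<alpha> z = \<alpha>'" by (auto simp: x_def \<alpha>_def z_def)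
      have bz: "b j i z = ?b j i" if i: "i \<in> I" for j i
      proof (cases "j = j1")
        case True
        have "0 = (\<Sum>j\<in>T. \<alpha>' j * quad_grad I (Q j) (?b j) x' i)" using *(2) i by simp
        also have "\<dots> = quad_grad I (Q j1) (?b j1) x' i
            + (\<Sum>j\<in>?T. \<alpha>' j * quad_grad I (Q j) (?b j) x' i)"
          by (subst sum.remove[OF fin(2) j1]) (simp add: *(1))
        also have "quad_grad I (Q j1) (?b j1) x' i = quad_grad I (Q j1) (\<lambda>_. 0) x' i + ?b j1 i"
          by (simp add: quad_grad_def)
        finally show ?thesis unfolding True b_def xz \<alpha>z by (simp add: z_def)
      next
        case False
        then show ?thesis by (simp add: b_def z_def)
      qed
      have "y k = G k z" if "k \<in> ?K" for k
        using that
      proof (elim PlusE)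
        fix p assume "p \<in> T \<times> I" "k = Inl p"
        then show ?thesis using bz by (auto simp: G_def)
      next
        fix j assume j: "j \<in> T" "k = Inr j"
        have "quad I (Q j) (\<lambda>i. b j i z) (x z) = quad I (Q j) (?b j) x'"
          unfolding xz quad_def using bz by simp
        then show ?thesis using *(3) j by (simp add: G_def)
      qed
      then show False using no by blast
    qed
  qed
qed

lemma generic_grads_independent:
  fixes Q :: "'j \<Rightarrow> 'i \<Rightarrow> 'i \<Rightarrow> real"
  assumes fin: "finite I" "finite S"
  shows "generic ((S \<times> I) <+> S) (\<lambda>y. \<forall>T\<in>Pow S. \<forall>x.
      (\<forall>j\<in>T. quad I (Q j) (\<lambda>i. y (Inl (j, i))) x = y (Inr j)) \<longrightarrow>
      grads_independent I Q (\<lambda>j i. y (Inl (j, i))) T x)"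
proof (rule generic_ball)
  show "finite (Pow S)" using fin by simp
  fix T assume "T \<in> Pow S"
  then have T: "T \<subseteq> S" "finite T" using fin finite_subset by auto
  have "generic ((S \<times> I) <+> S) (\<lambda>y. \<forall>j1\<in>T. \<not> (\<exists>x \<alpha>. \<alpha> j1 = 1 \<and>
      (\<forall>i\<in>I. (\<Sum>j\<in>T. \<alpha> j * quad_grad I (Q j) (\<lambda>i. y (Inl (j, i))) x i) = 0) \<and>
      (\<forall>j\<in>T. quad I (Q j) (\<lambda>i. y (Inl (j, i))) x = y (Inr j))))"
  proof (rule generic_ball[OF T(2)])
    fix j1 assume j1: "j1 \<in> T"
    show "generic ((S \<times> I) <+> S) (\<lambda>y. \<not> (\<exists>x \<alpha>. \<alpha> j1 = 1 \<and>
      (\<forall>i\<in>I. (\<Sum>j\<in>T. \<alpha> j * quad_grad I (Q j) (\<lambda>i. y (Inl (j, i))) x i) = 0) \<and>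
      (\<forall>j\<in>T. quad I (Q j) (\<lambda>i. y (Inl (j, i))) x = y (Inr j))))"
      by (rule generic_mono[OF generic_no_relation[OF fin(1) T(2) j1]]) (use fin T in auto)
  qed
  then show "generic ((S \<times> I) <+> S) (\<lambda>y. \<forall>x.
      (\<forall>j\<in>T. quad I (Q j) (\<lambda>i. y (Inl (j, i))) x = y (Inr j)) \<longrightarrow>
      grads_independent I Q (\<lambda>j i. y (Inl (j, i))) T x)"
  proof (rule generic_imp)
    fix y :: "('j \<times> 'i) + 'j \<Rightarrow> real"
    let ?b = "\<lambda>j i. y (Inl (j, i))"
    assume no: "\<forall>j1\<in>T. \<not> (\<exists>x \<alpha>. \<alpha> j1 = 1 \<and>
      (\<forall>i\<in>I. (\<Sum>j\<in>T. \<alpha> j * quad_grad I (Q j) (?b j) x i) = 0) \<and>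
      (\<forall>j\<in>T. quad I (Q j) (?b j) x = y (Inr j)))"
    show "\<forall>x. (\<forall>j\<in>T. quad I (Q j) (?b j) x = y (Inr j)) \<longrightarrow> grads_independent I Q ?b T x"
    proof (intro allI impI)
      fix x assume x: "\<forall>j\<in>T. quad I (Q j) (?b j) x = y (Inr j)"
      have "\<alpha> j1 = 0" if \<alpha>: "\<forall>i\<in>I. (\<Sum>j\<in>T. \<alpha> j * quad_grad I (Q j) (?b j) x i) = 0"
        and j1: "j1 \<in> T" for \<alpha> j1
      proof (rule ccontr)
        assume nz: "\<alpha> j1 \<noteq> 0"
        let ?\<beta> = "\<lambda>j. \<alpha> j / \<alpha> j1"
        have "(\<Sum>j\<in>T. ?\<beta> j * quad_grad I (Q j) (?b j) x i)
            = (\<Sum>j\<in>T. \<alpha> j * quad_grad I (Q j) (?b j) x i) / \<alpha> j1" for i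
          by (simp add: sum_divide_distrib)
        then have "?\<beta> j1 = 1 \<and> (\<forall>i\<in>I. (\<Sum>j\<in>T. ?\<beta> j * quad_grad I (Q j) (?b j) x i) = 0) \<and>
            (\<forall>j\<in>T. quad I (Q j) (?b j) x = y (Inr j))"
          using nz \<alpha> x by simp
        then have "\<exists>x \<alpha>. \<alpha> j1 = 1 \<and> (\<forall>i\<in>I. (\<Sum>j\<in>T. \<alpha> j * quad_grad I (Q j) (?b j) x i) = 0) \<and>
            (\<forall>j\<in>T. quad I (Q j) (?b j) x = y (Inr j))"
          by (intro exI[of _ x] exI[of _ ?\<beta>])
        then show False using bspec[OF no j1] by contradiction
      qed
      then show "grads_independent I Q ?b T x" unfolding grads_independent_def by blast
    qed
  qed
qed

text \<open>The solutions of the Lagrange equations for the distance to \<open>a\<close> on the variety where the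
constraints in \<open>J\<close> are active.\<close>

definition critical_points ::
  "'i set \<Rightarrow> ('j \<Rightarrow> 'i \<Rightarrow> 'i \<Rightarrow> real) \<Rightarrow> ('j \<Rightarrow> 'i \<Rightarrow> real) \<Rightarrow> ('j \<Rightarrow> real) \<Rightarrow> ('i \<Rightarrow> real) \<Rightarrow> 'j set \<Rightarrow>
    ('i \<Rightarrow> real) set" where
  "critical_points I Q b c a J = {x. (\<forall>i. i \<notin> I \<longrightarrow> x i = 0) \<and> (\<forall>j\<in>J. quad I (Q j) (b j) x = c j) \<and>
      (\<exists>\<alpha>. \<forall>i\<in>I. x i - a i = (\<Sum>j\<in>J. \<alpha> j * quad_grad I (Q j) (b j) x i))}"

text \<open>The Lagrange equations are a square system of quadratic equations in \<open>x\<close> and the multipliers,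
with right-hand side \<open>(a, c)\<close>. So the critical points are bounded by the size of a fibre of a
quadratic map of a space of dimension \<open>card I + card J\<close> to itself.\<close>

lemma generic_critical_points:
  fixes Q :: "'j \<Rightarrow> 'i \<Rightarrow> 'i \<Rightarrow> real" and b :: "'j \<Rightarrow> 'i \<Rightarrow> real"
  assumes fin: "finite I" "finite J"
  shows "generic (I <+> J) (\<lambda>y.
    finite (critical_points I Q b (\<lambda>j. y (Inr j)) (\<lambda>i. y (Inl i)) J) \<and>
    card (critical_points I Q b (\<lambda>j. y (Inr j)) (\<lambda>i. y (Inl i)) J) \<le> 2 ^ (card I + card J))"
proof -
  let ?A = "I <+> J"
  define F where "F = case_sum
      (\<lambda>i (z :: 'i + 'j \<Rightarrow> real). z (Inl i) - (\<Sum>j\<in>J. z (Inr j) * quad_grad I (Q j) (b j) (\<lambda>i. z (Inl i)) i))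
      (\<lambda>j z. quad I (Q j) (b j) (\<lambda>i. z (Inl i)))"
  have finA: "finite ?A" using fin by simp
  have v: "(\<lambda>z. z (Inl i)) \<in> poly_upto ?A D" if "i \<in> I" "D \<ge> 1" for i D
    using that by (intro poly_upto_var finA) auto
  have w: "(\<lambda>z. z (Inr j)) \<in> poly_upto ?A 1" if "j \<in> J" for j
    using that by (intro poly_upto_var finA) auto
  have g: "(\<lambda>z. quad_grad I (Q j) (b j) (\<lambda>i. z (Inl i)) i) \<in> poly_upto ?A 1" for i j
    unfolding quad_grad_def
    by (intro poly_upto_add poly_upto_sum poly_upto_cmult poly_upto_const finA v order_refl)
  have F: "F k \<in> poly_upto ?A (1 + 1)" if "k \<in> ?A" for k
    using that
  proof (elim PlusE)
    fix i assume i: "i \<in> I" "k = Inl i"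
    have "(\<lambda>z. \<Sum>j\<in>J. z (Inr j) * quad_grad I (Q j) (b j) (\<lambda>i. z (Inl i)) i) \<in> poly_upto ?A (1 + 1)"
      by (intro poly_upto_sum poly_upto_mult finA w g)
    then show ?thesis unfolding F_def i(2) sum.case using v[OF i(1)] by (intro poly_upto_diff) simp_all
  next
    fix j assume j: "j \<in> J" "k = Inr j"
    have "(\<lambda>z. Q j i l * z (Inl i) * z (Inl l)) \<in> poly_upto ?A (1 + 1)" if "i \<in> I" "l \<in> I" for i l
      by (intro poly_upto_mult poly_upto_cmult finA v that order_refl)
    then have "(\<lambda>z. \<Sum>i\<in>I. \<Sum>l\<in>I. Q j i l * z (Inl i) * z (Inl l)) \<in> poly_upto ?A (1 + 1)"
      by (intro poly_upto_sum)
    moreover have "(\<lambda>z. \<Sum>i\<in>I. b j i * z (Inl i)) \<in> poly_upto ?A (1 + 1)"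
      by (intro poly_upto_sum poly_upto_cmult v) simp_all
    ultimately show ?thesis unfolding F_def j(2) sum.case quad_def by (rule poly_upto_add)
  qed
  have gen: "generic ?A (\<lambda>y. \<forall>X. finite X \<longrightarrow> inj_on (\<lambda>x. restrict x ?A) X \<longrightarrow>
      (\<forall>x\<in>X. \<forall>k\<in>?A. F k x = y k) \<longrightarrow> card X \<le> (1 + 1) ^ card ?A)"
    by (rule generic_fibre_card[OF finA finA refl]) (rule F)
  then show ?thesis
  proof (rule generic_imp)
    fix y
    let ?C = "critical_points I Q b (\<lambda>j. y (Inr j)) (\<lambda>i. y (Inl i)) J"
    assume bound: "\<forall>X. finite X \<longrightarrow> inj_on (\<lambda>x. restrict x ?A) X \<longrightarrow>
      (\<forall>x\<in>X. \<forall>k\<in>?A. F k x = y k) \<longrightarrow> card X \<le> (1 + 1) ^ card ?A"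
    have "card X \<le> 2 ^ (card I + card J)" if X: "X \<subseteq> ?C" "finite X" for X
    proof -
      have "\<forall>x\<in>X. \<exists>\<alpha>. \<forall>i\<in>I. x i - y (Inl i) = (\<Sum>j\<in>J. \<alpha> j * quad_grad I (Q j) (b j) x i)"
        using X(1) unfolding critical_points_def by blast
      from bchoice[OF this] obtain \<alpha> where
        \<alpha>: "\<forall>x\<in>X. \<forall>i\<in>I. x i - y (Inl i) = (\<Sum>j\<in>J. \<alpha> x j * quad_grad I (Q j) (b j) x i)"
        by (elim exE)
      let ?z = "\<lambda>x. case_sum x (\<alpha> x)"
      have inj: "x = x'" if "x \<in> X" "x' \<in> X" "restrict (?z x) ?A = restrict (?z x') ?A" for x x'
      proof
        fix i show "x i = x' i"
        proof (cases "i \<in> I")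
          case True
          then show ?thesis using fun_cong[OF that(3), of "Inl i"] InlI[OF True, of J] by simp
        next
          case False
          have "x \<in> ?C" "x' \<in> ?C" using that(1,2) X(1) by blast+
          then show ?thesis using False by (simp add: critical_points_def)
        qed
      qed
      have fz: "finite (?z ` X)" using X(2) by simp
      have iz: "inj_on (\<lambda>x. restrict x ?A) (?z ` X)"
      proof (rule inj_onI)
        fix z z' assume z: "z \<in> ?z ` X" "z' \<in> ?z ` X" "restrict z ?A = restrict z' ?A"
        from z(1) obtain x where x: "x \<in> X" "z = ?z x" by (rule imageE)
        from z(2) obtain x' where x': "x' \<in> X" "z' = ?z x'" by (rule imageE)
        have "x = x'" by (rule inj[OF x(1) x'(1)]) (use z(3) x(2) x'(2) in simp)
        then show "z = z'" using x(2) x'(2) by simp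
      qed
      have "\<forall>x\<in>?z ` X. \<forall>k\<in>?A. F k x = y k"
      proof (intro ballI)
        fix z k assume z: "z \<in> ?z ` X" and k: "k \<in> ?A"
        from z obtain x where x: "x \<in> X" "z = ?z x" by (rule imageE)
        from k show "F k z = y k"
        proof (elim PlusE)
          fix i assume i: "i \<in> I" "k = Inl i"
          have "x i - y (Inl i) = (\<Sum>j\<in>J. \<alpha> x j * quad_grad I (Q j) (b j) x i)"
            using bspec[OF bspec[OF \<alpha> x(1)] i(1)] .
          then have "x i - (\<Sum>j\<in>J. \<alpha> x j * quad_grad I (Q j) (b j) x i) = y (Inl i)" by linarith
          then show ?thesis unfolding F_def i(2) x(2) sum.case .
        next
          fix j assume j: "j \<in> J" "k = Inr j"
          have "x \<in> ?C" using X(1) x(1) by blast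
          then have "quad I (Q j) (b j) x = y (Inr j)" using j(1) by (simp add: critical_points_def)
          then show ?thesis unfolding F_def j(2) x(2) sum.case .
        qed
      qed
      from mp[OF mp[OF mp[OF spec[OF bound] fz] iz] this]
      have "card (?z ` X) \<le> (1 + 1) ^ card ?A" .
      moreover have "card (?z ` X) = card X"
      proof (rule card_image, rule inj_onI)
        fix x x' assume x: "x \<in> X" "x' \<in> X" "?z x = ?z x'"
        show "x = x'" by (rule inj[OF x(1,2)]) (simp only: x(3))
      qed
      ultimately show ?thesis unfolding card_Plus[OF fin] one_add_one by simp
    qed
    then show "finite ?C \<and> card ?C \<le> 2 ^ (card I + card J)"
      by (rule finite_if_finite_subsets_card_bdd) 
  qed
qed

section \<open>Counting sign patterns of quadratic polynomials\<close>

text \<open>The strict sign vectors of Warren's theorem, each encoded as the set of its positive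
entries.\<close>

definition patterns ::
  "'i set \<Rightarrow> 'j set \<Rightarrow> ('j \<Rightarrow> 'i \<Rightarrow> 'i \<Rightarrow> real) \<Rightarrow> ('j \<Rightarrow> 'i \<Rightarrow> real) \<Rightarrow> ('j \<Rightarrow> real) \<Rightarrow> 'j set set" where
  "patterns I S Q b c =
    {{j \<in> S. quad I (Q j) (b j) x > c j} | x. \<forall>j\<in>S. quad I (Q j) (b j) x \<noteq> c j}"

lemma finite_patterns: "finite S \<Longrightarrow> finite (patterns I S Q b c)"
  by (rule finite_subset[of _ "Pow S"]) (auto simp: patterns_def)

text \<open>Every pattern is witnessed by a single point, at which all finitely many values keep a positive
distance from their levels. This is what permits replacing the given polynomials by generic ones.\<close>

lemma patterns_stable:
  assumes fin: "finite I" "finite S"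
  shows "\<exists>\<epsilon>>0. \<forall>b' c'. (\<forall>j\<in>S. \<forall>i\<in>I. \<bar>b' j i - b j i\<bar> < \<epsilon>) \<longrightarrow> (\<forall>j\<in>S. \<bar>c' j - c j\<bar> < \<epsilon>) \<longrightarrow>
    patterns I S Q b c \<subseteq> patterns I S Q b' c'"
proof -
  let ?P = "patterns I S Q b c" and ?q = "\<lambda>j. quad I (Q j) (b j)"
  have "\<forall>P\<in>?P. \<exists>x. P = {j \<in> S. ?q j x > c j} \<and> (\<forall>j\<in>S. ?q j x \<noteq> c j)"
    unfolding patterns_def by blast
  from bchoice[OF this] obtain w where
    w: "\<forall>P\<in>?P. P = {j \<in> S. ?q j (w P) > c j} \<and> (\<forall>j\<in>S. ?q j (w P) \<noteq> c j)"
    by (elim exE)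
  \<comment> \<open>A perturbation of all parameters by less than \<open>\<epsilon>\<close> changes the difference of value and level at \<open>x\<close> by less than \<open>\<epsilon> * m x\<close>.\<close>
  define m where "m x = 1 + (\<Sum>i\<in>I. \<bar>x i\<bar>)" for x :: "'a \<Rightarrow> real"
  have m: "m x > 0" for x unfolding m_def by (smt (verit) sum_nonneg abs_ge_zero)
  let ?E = "insert 1 ((\<lambda>(P, j). \<bar>?q j (w P) - c j\<bar> / m (w P)) ` (?P \<times> S))"
  define \<epsilon> where "\<epsilon> = Min ?E"
  have finE: "finite ?E" by (intro finite.insertI finite_imageI finite_cartesian_product finite_patterns fin)
  have "\<epsilon> > 0" unfolding \<epsilon>_def using finE w m by (subst Min_gr_iff) auto
  moreover have "?P \<subseteq> patterns I S Q b' c'"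
    if b': "\<forall>j\<in>S. \<forall>i\<in>I. \<bar>b' j i - b j i\<bar> < \<epsilon>" and c': "\<forall>j\<in>S. \<bar>c' j - c j\<bar> < \<epsilon>" for b' c'
  proof
    fix P assume P: "P \<in> ?P"
    let ?w = "w P"
    have close: "\<bar>(quad I (Q j) (b' j) ?w - c' j) - (?q j ?w - c j)\<bar> < \<bar>?q j ?w - c j\<bar>" if j: "j \<in> S" for j
    proof -
      have "(quad I (Q j) (b' j) ?w - c' j) - (?q j ?w - c j)
          = (\<Sum>i\<in>I. (b' j i - b j i) * ?w i) - (c' j - c j)"
        by (simp add: quad_def left_diff_distrib sum_subtractf)
      also have "\<bar>\<dots>\<bar> \<le> (\<Sum>i\<in>I. \<bar>b' j i - b j i\<bar> * \<bar>?w i\<bar>) + \<bar>c' j - c j\<bar>"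
        using sum_abs[of "\<lambda>i. (b' j i - b j i) * ?w i" I] by (simp add: abs_mult)
      also have "\<dots> < \<epsilon> * (\<Sum>i\<in>I. \<bar>?w i\<bar>) + \<epsilon>"
      proof (rule add_le_less_mono)
        show "(\<Sum>i\<in>I. \<bar>b' j i - b j i\<bar> * \<bar>?w i\<bar>) \<le> \<epsilon> * (\<Sum>i\<in>I. \<bar>?w i\<bar>)"
          unfolding sum_distrib_left using b' j by (intro sum_mono mult_right_mono) (auto intro: less_imp_le)
        show "\<bar>c' j - c j\<bar> < \<epsilon>" using c' j by blast
      qed
      also have "\<dots> = \<epsilon> * m ?w" by (simp add: m_def algebra_simps)
      also have "\<dots> \<le> \<bar>?q j ?w - c j\<bar>"
      proof -
        have "\<bar>?q j ?w - c j\<bar> / m ?w \<in> ?E" using P j by force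
        then have "\<epsilon> \<le> \<bar>?q j ?w - c j\<bar> / m ?w" unfolding \<epsilon>_def by (rule Min_le[OF finE])
        then show ?thesis using m[of ?w] by (simp add: pos_le_divide_eq)
      qed
      finally show ?thesis .
    qed
    have ne: "\<forall>j\<in>S. quad I (Q j) (b' j) ?w \<noteq> c' j" using close by fastforce
    have "P = {j \<in> S. ?q j ?w > c j}" using w P by blast
    also have "\<dots> = {j \<in> S. quad I (Q j) (b' j) ?w > c' j}"
    proof (rule Collect_cong, rule conj_cong[OF refl])
      fix j assume "j \<in> S"
      from close[OF this] show "(?q j ?w > c j) = (quad I (Q j) (b' j) ?w > c' j)" by linarith
    qed
    finally show "P \<in> patterns I S Q b' c'" unfolding patterns_def using ne by blast
  qed
  ultimately show ?thesis by blast
qed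

lemma grads_independent_card:
  assumes "finite I" "finite J" "grads_independent I Q b J x"
  shows "card J \<le> card I"
proof (rule ccontr)
  assume "\<not> card J \<le> card I"
  then have "card I < card J" by simp
  from nontrivial_relation[OF assms(1,2) this, of "\<lambda>j i. quad_grad I (Q j) (b j) x i"]
  show False using assms(3) unfolding grads_independent_def by blast
qed

text \<open>Take for \<open>x\<close> the point nearest to \<open>a\<close> in the closed region belonging to \<open>P\<close>, and
for \<open>J\<close> the constraints that are active at \<open>x\<close>. Outside \<open>J\<close> the pattern can be
read off at \<open>x\<close>, so \<open>P\<close> is determined by \<open>J\<close>, \<open>x\<close> and \<open>P \<inter> J\<close>.\<close>

lemma pattern_has_critical_point:
  assumes fin: "finite I" "finite S"
    and indep: "\<And>T x. T \<subseteq> S \<Longrightarrow> (\<forall>j\<in>T. quad I (Q j) (b j) x = c j) \<Longrightarrow> grads_independent I Q b T x"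
    and P: "P \<in> patterns I S Q b c"
  shows "\<exists>J x. J \<subseteq> S \<and> card J \<le> card I \<and> x \<in> critical_points I Q b c a J \<and>
    P = {j \<in> S. quad I (Q j) (b j) x > c j} \<union> (P \<inter> J)"
proof -
  let ?q = "\<lambda>j. quad I (Q j) (b j)"
  define \<sigma> where "\<sigma> j = (if j \<in> P then 1 else - 1 :: real)" for j
  define W where "W = {x. \<forall>j\<in>S. \<sigma> j * (?q j x - c j) \<ge> 0}"
  obtain w where w: "P = {j \<in> S. ?q j w > c j}" "\<forall>j\<in>S. ?q j w \<noteq> c j"
    using P unfolding patterns_def by blast
  let ?w = "\<lambda>i. if i \<in> I then w i else 0"
  have "?q j ?w = ?q j w" for j by (rule quad_cong) simp
  then have "?w \<in> W" using w unfolding W_def \<sigma>_def by auto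
  moreover have "closed W"
    unfolding W_def Ball_def
    by (intro closed_Collect_all closed_Collect_imp closed_Collect_le open_Collect_const
        continuous_intros continuous_on_quad)
  ultimately obtain x where x: "x \<in> W" "\<forall>i. i \<notin> I \<longrightarrow> x i = 0"
    "\<forall>x'\<in>W. (\<forall>i. i \<notin> I \<longrightarrow> x' i = 0) \<longrightarrow> (\<Sum>i\<in>I. (x i - a i)\<^sup>2) \<le> (\<Sum>i\<in>I. (x' i - a i)\<^sup>2)"
    using nearest_point_exists[OF fin(1), of W ?w a] by auto
  let ?J = "{j\<in>S. ?q j x = c j}"
  have gi: "grads_independent I Q b ?J x" by (rule indep) auto
  have "\<exists>\<alpha>. \<forall>i\<in>I. x i - a i = (\<Sum>j\<in>?J. \<alpha> j * quad_grad I (Q j) (b j) x i)"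
  proof (rule nearest_point_dependent[OF fin, of \<sigma>])
    show "\<sigma> j = 1 \<or> \<sigma> j = - 1" if "j \<in> S" for j by (simp add: \<sigma>_def)
    show "0 \<le> \<sigma> j * (?q j x - c j)" if "j \<in> S" for j using x(1) that by (simp add: W_def)
    show "\<forall>i. i \<notin> I \<longrightarrow> x i = 0" by (rule x(2))
    show "(\<Sum>i\<in>I. (x i - a i)\<^sup>2) \<le> (\<Sum>i\<in>I. (x' i - a i)\<^sup>2)"
      if "\<And>j. j \<in> S \<Longrightarrow> 0 \<le> \<sigma> j * (?q j x' - c j)" "\<forall>i. i \<notin> I \<longrightarrow> x' i = 0" for x'
      using x(3) that by (simp add: W_def)
    show "\<forall>j\<in>?J. \<alpha> j = 0"
      if "\<And>i. i \<in> I \<Longrightarrow> (\<Sum>j\<in>?J. \<alpha> j * quad_grad I (Q j) (b j) x i) = 0" for \<alpha>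
      using gi that unfolding grads_independent_def by blast
  qed
  then have "x \<in> critical_points I Q b c a ?J"
    unfolding critical_points_def using x(2) by blast
  moreover have "card ?J \<le> card I"
    by (rule grads_independent_card[OF fin(1) _ gi]) (use fin in simp)
  moreover have "P = {j \<in> S. ?q j x > c j} \<union> (P \<inter> ?J)"
  proof (intro equalityI subsetI)
    fix j assume j: "j \<in> P"
    then have "j \<in> S" using w(1) by blast
    moreover from this have "?q j x - c j \<ge> 0" using x(1) j by (force simp: W_def \<sigma>_def)
    ultimately show "j \<in> {j \<in> S. ?q j x > c j} \<union> (P \<inter> ?J)" using j by auto
  next
    fix j assume "j \<in> {j \<in> S. ?q j x > c j} \<union> (P \<inter> ?J)"
    moreover have False if "j \<in> S" "?q j x > c j" "j \<notin> P"
      using x(1) that by (force simp: W_def \<sigma>_def)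
    ultimately show "j \<in> P" by blast
  qed
  ultimately show ?thesis by (intro exI[of _ ?J] exI[of _ x]) auto
qed

text \<open>A set \<open>J\<close> accounts for at most \<open>2 ^ (card I + card J)\<close> critical points, each of them
shared by at most \<open>2 ^ card J\<close> patterns, which differ only on \<open>J\<close>.\<close>

lemma card_patterns_nondegenerate:
  assumes fin: "finite I" "finite S"
    and indep: "\<And>T x. T \<subseteq> S \<Longrightarrow> (\<forall>j\<in>T. quad I (Q j) (b j) x = c j) \<Longrightarrow> grads_independent I Q b T x"
    and crit: "\<And>J. J \<subseteq> S \<Longrightarrow> finite (critical_points I Q b c a J) \<and>
      card (critical_points I Q b c a J) \<le> 2 ^ (card I + card J)"
  shows "card (patterns I S Q b c) \<le> (\<Sum>J | J \<subseteq> S \<and> card J \<le> card I. 2 ^ card I * 4 ^ card J)"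
proof -
  let ?\<J> = "{J. J \<subseteq> S \<and> card J \<le> card I}"
  let ?C = "\<lambda>J. critical_points I Q b c a J"
  let ?f = "\<lambda>(x, B). {j \<in> S. quad I (Q j) (b j) x > c j} \<union> B"
  have fin\<J>: "finite ?\<J>" by (rule finite_subset[of _ "Pow S"]) (use fin in auto)
  have finJ: "finite J" if "J \<in> ?\<J>" for J using that fin(2) finite_subset by auto
  have sub: "patterns I S Q b c \<subseteq> (\<Union>J\<in>?\<J>. ?f ` (?C J \<times> Pow J))"
  proof
    fix P assume P: "P \<in> patterns I S Q b c"
    have "\<exists>J x. J \<subseteq> S \<and> card J \<le> card I \<and> x \<in> ?C J \<and>
        P = {j \<in> S. quad I (Q j) (b j) x > c j} \<union> (P \<inter> J)"
      by (rule pattern_has_critical_point[OF fin _ P]) (rule indep)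
    then obtain J x where "J \<subseteq> S \<and> card J \<le> card I \<and> x \<in> ?C J \<and>
        P = {j \<in> S. quad I (Q j) (b j) x > c j} \<union> (P \<inter> J)" by (elim exE)
    then have J: "J \<in> ?\<J>" "x \<in> ?C J" "P = ?f (x, P \<inter> J)" by simp_all
    have "(x, P \<inter> J) \<in> ?C J \<times> Pow J" using J(2) by blast
    then have "P \<in> ?f ` (?C J \<times> Pow J)" using J(3) by (rule image_eqI[rotated])
    then show "P \<in> (\<Union>J\<in>?\<J>. ?f ` (?C J \<times> Pow J))" using J(1) by blast
  qed
  have finC: "finite (?C J \<times> Pow J)" if "J \<in> ?\<J>" for J
    using crit[of J] finJ[OF that] that by simp
  have "card (patterns I S Q b c) \<le> card (\<Union>J\<in>?\<J>. ?f ` (?C J \<times> Pow J))"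
    by (rule card_mono[OF _ sub]) (intro finite_UN_I fin\<J> finite_imageI finC)
  also have "\<dots> \<le> (\<Sum>J\<in>?\<J>. card (?f ` (?C J \<times> Pow J)))" by (rule card_UN_le[OF fin\<J>])
  also have "\<dots> \<le> (\<Sum>J\<in>?\<J>. 2 ^ card I * 4 ^ card J)"
  proof (rule sum_mono)
    fix J assume J: "J \<in> ?\<J>"
    have "card (?f ` (?C J \<times> Pow J)) \<le> card (?C J \<times> Pow J)" by (rule card_image_le[OF finC[OF J]])
    also have "\<dots> = card (?C J) * 2 ^ card J"
      using finJ[OF J] by (simp add: card_cartesian_product card_Pow)
    also have "\<dots> \<le> 2 ^ (card I + card J) * 2 ^ card J" using crit[of J] J by simp
    also have "\<dots> = 2 ^ card I * 4 ^ card J"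
      by (simp add: power_add mult.assoc flip: power_mult_distrib)
    finally show "card (?f ` (?C J \<times> Pow J)) \<le> 2 ^ card I * 4 ^ card J" .
  qed
  finally show ?thesis .
qed

text \<open>The linear parts are perturbed first, to make the gradients of simultaneously active constraints
independent. The generic choice of the base point \<open>a\<close> and of the levels comes second because
the polynomials describing the exceptional choices involve the linear parts.\<close>

theorem card_patterns:
  fixes Q :: "'j \<Rightarrow> 'i \<Rightarrow> 'i \<Rightarrow> real"
  assumes fin: "finite I" "finite S"
  shows "card (patterns I S Q b c) \<le> (\<Sum>J | J \<subseteq> S \<and> card J \<le> card I. 2 ^ card I * 4 ^ card J)"
proof -
  obtain \<epsilon> where \<epsilon>: "\<epsilon> > 0" and stable: "\<forall>b' c'. (\<forall>j\<in>S. \<forall>i\<in>I. \<bar>b' j i - b j i\<bar> < \<epsilon>) \<longrightarrow>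
      (\<forall>j\<in>S. \<bar>c' j - c j\<bar> < \<epsilon>) \<longrightarrow> patterns I S Q b c \<subseteq> patterns I S Q b' c'"
    using patterns_stable[OF fin, of b c Q] by blast
  have fin2: "finite (S \<times> I)" "finite (I <+> S)" using fin by auto
  from generic_section[OF generic_grads_independent[OF fin, of Q] fin2(1) fin(2) \<epsilon>, of "\<lambda>(j, i). b j i"]
  obtain u where u: "\<forall>p\<in>S \<times> I. \<bar>u p - (case p of (j, i) \<Rightarrow> b j i)\<bar> < \<epsilon>"
    and gen: "generic S (\<lambda>v. \<forall>T\<in>Pow S. \<forall>x.
      (\<forall>j\<in>T. quad I (Q j) (\<lambda>i. case_sum u v (Inl (j, i))) x = case_sum u v (Inr j)) \<longrightarrow>
      grads_independent I Q (\<lambda>j i. case_sum u v (Inl (j, i))) T x)"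
    by (elim exE conjE)
  define b' where "b' j i = u (j, i)" for j i
  have b': "\<forall>j\<in>S. \<forall>i\<in>I. \<bar>b' j i - b j i\<bar> < \<epsilon>" using u unfolding b'_def by force
  have gen1: "generic S (\<lambda>v. \<forall>T\<in>Pow S. \<forall>x.
      (\<forall>j\<in>T. quad I (Q j) (b' j) x = v j) \<longrightarrow> grads_independent I Q b' T x)"
    using gen unfolding b'_def sum.case .
  have gen1': "generic (I <+> S) (\<lambda>y. \<forall>T\<in>Pow S. \<forall>x.
      (\<forall>j\<in>T. quad I (Q j) (b' j) x = y (Inr j)) \<longrightarrow> grads_independent I Q b' T x)"
    by (rule generic_reindex[OF gen1 fin(2) fin2(2), of Inr]) auto
  have gen2: "generic (I <+> S) (\<lambda>y. \<forall>J\<in>Pow S.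
      finite (critical_points I Q b' (\<lambda>j. y (Inr j)) (\<lambda>i. y (Inl i)) J) \<and>
      card (critical_points I Q b' (\<lambda>j. y (Inr j)) (\<lambda>i. y (Inl i)) J) \<le> 2 ^ (card I + card J))"
  proof (rule generic_ball)
    show "finite (Pow S)" using fin by simp
    fix J assume "J \<in> Pow S"
    then have J: "J \<subseteq> S" "finite J" using fin(2) finite_subset by auto
    show "generic (I <+> S) (\<lambda>y.
      finite (critical_points I Q b' (\<lambda>j. y (Inr j)) (\<lambda>i. y (Inl i)) J) \<and>
      card (critical_points I Q b' (\<lambda>j. y (Inr j)) (\<lambda>i. y (Inl i)) J) \<le> 2 ^ (card I + card J))"
      by (rule generic_mono[OF generic_critical_points[OF fin(1) J(2)] fin2(2)]) (use J in auto)
  qed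
  from generic_exists_near[OF generic_conj[OF gen1' gen2] fin2(2) \<epsilon>, of "case_sum (\<lambda>_. 0) c"]
  obtain y where near: "\<forall>k\<in>I <+> S. \<bar>y k - case_sum (\<lambda>_. 0) c k\<bar> < \<epsilon>"
    and indep: "\<forall>T\<in>Pow S. \<forall>x.
      (\<forall>j\<in>T. quad I (Q j) (b' j) x = y (Inr j)) \<longrightarrow> grads_independent I Q b' T x"
    and crit: "\<forall>J\<in>Pow S. finite (critical_points I Q b' (\<lambda>j. y (Inr j)) (\<lambda>i. y (Inl i)) J) \<and>
      card (critical_points I Q b' (\<lambda>j. y (Inr j)) (\<lambda>i. y (Inl i)) J) \<le> 2 ^ (card I + card J)"
    by (elim exE conjE)
  define c' where "c' j = y (Inr j)" for j
  have "\<forall>j\<in>S. \<bar>c' j - c j\<bar> < \<epsilon>" using near unfolding c'_def by force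
  then have "patterns I S Q b c \<subseteq> patterns I S Q b' c'" using stable b' by blast
  then have "card (patterns I S Q b c) \<le> card (patterns I S Q b' c')"
    by (rule card_mono[OF finite_patterns[OF fin(2)]])
  also have "\<dots> \<le> (\<Sum>J | J \<subseteq> S \<and> card J \<le> card I. 2 ^ card I * 4 ^ card J)"
  proof (rule card_patterns_nondegenerate[OF fin])
    fix T x assume "T \<subseteq> S" "\<forall>j\<in>T. quad I (Q j) (b' j) x = c' j"
    then show "grads_independent I Q b' T x" using indep unfolding c'_def by simp
  next
    fix J assume "J \<subseteq> S"
    then show "finite (critical_points I Q b' c' (\<lambda>i. y (Inl i)) J) \<and>
        card (critical_points I Q b' c' (\<lambda>i. y (Inl i)) J) \<le> 2 ^ (card I + card J)"
      using bspec[OF crit, of J] unfolding c'_def[abs_def] by simp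
  qed
  finally show ?thesis .
qed

section \<open>Edge orders as sign patterns\<close>

text \<open>Each small subset \<open>J\<close> has weight at least one in \<open>(s / N) ^ N * (N / s) ^ card J\<close>; summed
over all subsets of \<open>S\<close> this gives \<open>(s / N) ^ N * (1 + N / s) ^ card S\<close>, and the last factor
is at most \<open>exp N\<close>.\<close>

lemma sum_small_subsets_le:
  fixes s :: real
  assumes "finite S" "real (card S) \<le> s" "real N \<le> s" "N \<ge> 1"
  shows "(\<Sum>J | J \<subseteq> S \<and> card J \<le> N. 2 ^ N * 4 ^ card J) \<le> (8 * exp 1 * s / real N) ^ N"
proof -
  let ?r = "real N / s"
  have s: "s > 0" using assms(3,4) by linarith
  have r: "0 \<le> ?r" "1 \<le> s / real N" using s assms(3,4) by (auto simp: field_simps)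
  have fin: "finite {J. J \<subseteq> S \<and> card J \<le> N}"
    by (rule finite_subset[of _ "Pow S"]) (use assms(1) in auto)
  have weight: "2 ^ N * 4 ^ card J \<le> (8 * s / real N) ^ N * ?r ^ card J" if "card J \<le> N" for J :: "'a set"
  proof -
    have "(4::real) ^ card J \<le> 4 ^ N" using that by (intro power_increasing) auto
    moreover have "1 \<le> (s / real N) ^ N * ?r ^ card J"
    proof -
      have "(s / real N) ^ N = (s / real N) ^ (N - card J) * (s / real N) ^ card J"
        using that by (simp flip: power_add)
      moreover have "(s / real N) ^ card J * ?r ^ card J = 1"
        using s assms(4) by (simp flip: power_mult_distrib)
      ultimately have "(s / real N) ^ N * ?r ^ card J = (s / real N) ^ (N - card J)"
        by (simp add: mult.assoc)
      then show ?thesis using one_le_power[OF r(2)] by simp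
    qed
    ultimately have "4 ^ card J * 1 \<le> 4 ^ N * ((s / real N) ^ N * ?r ^ card J)"
      by (intro mult_mono) auto
    then have "2 ^ N * (4 ^ card J * 1) \<le> 2 ^ N * (4 ^ N * ((s / real N) ^ N * ?r ^ card J))"
      by (rule mult_left_mono) simp
    also have "\<dots> = (2 * (4 * (s / real N))) ^ N * ?r ^ card J"
      by (simp only: power_mult_distrib mult.assoc)
    finally show ?thesis by simp
  qed
  have "(\<Sum>J | J \<subseteq> S \<and> card J \<le> N. 2 ^ N * 4 ^ card J)
      \<le> (\<Sum>J | J \<subseteq> S \<and> card J \<le> N. (8 * s / real N) ^ N * ?r ^ card J)"
    using weight by (intro sum_mono) auto
  also have "\<dots> \<le> (\<Sum>J\<in>Pow S. (8 * s / real N) ^ N * ?r ^ card J)"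
    using assms(1) s by (intro sum_mono2) auto
  also have "\<dots> = (8 * s / real N) ^ N * (1 + ?r) ^ card S"
    using prod_add[OF assms(1), of "\<lambda>_. ?r" "\<lambda>_. 1"]
    by (simp add: sum_distrib_left add.commute)
  also have "(1 + ?r) ^ card S \<le> exp ?r ^ card S"
    using r by (intro power_mono) (auto simp: add.commute)
  also have "exp ?r ^ card S = exp (real (card S) * ?r)" by (rule exp_of_nat_mult[symmetric])
  also have "\<dots> \<le> exp (real N)" using s mult_right_mono[OF assms(2) r(1)] by simp
  also have "exp (real N) = exp 1 ^ N" by (simp flip: exp_of_nat_mult)
  finally have "(\<Sum>J | J \<subseteq> S \<and> card J \<le> N. 2 ^ N * 4 ^ card J) \<le> (8 * s / real N) ^ N * exp 1 ^ N"
    using s by (simp add: mult_left_mono)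
  then show ?thesis by (simp flip: power_mult_distrib add: mult_ac)
qed

text \<open>The signed incidence vector \<open>inc\<close> of an edge turns the squared edge length into a quadratic
form in the coordinates of all vertices, indexed by pairs of a vertex and an axis.\<close>

lemma edist_as_quad:
  fixes p :: "'v \<Rightarrow> nat \<Rightarrow> real" and u v :: 'v
  assumes "finite V" "u \<in> V" "v \<in> V" "u \<noteq> v"
  defines "inc \<equiv> \<lambda>w. (if w = u then 1 else 0) - (if w = v then 1 else (0::real))"
  shows "(\<Sum>k\<in>V \<times> {..<d}. \<Sum>l\<in>V \<times> {..<d}.
      (if snd k = snd l then inc (fst k) * inc (fst l) else 0) * p (fst k) (snd k) * p (fst l) (snd l))
    = (edist d (p u) (p v))\<^sup>2"
proof -
  have inc: "(\<Sum>w\<in>V. inc w * p w i) = p u i - p v i" for i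
  proof -
    have "(\<Sum>w\<in>V. inc w * p w i) = (\<Sum>w\<in>V. (if w = u then p w i else 0) - (if w = v then p w i else 0))"
      unfolding inc_def by (intro sum.cong) auto
    then show ?thesis using assms by (simp add: sum_subtractf)
  qed
  have "(\<Sum>k\<in>V \<times> {..<d}. \<Sum>l\<in>V \<times> {..<d}.
      (if snd k = snd l then inc (fst k) * inc (fst l) else 0) * p (fst k) (snd k) * p (fst l) (snd l))
    = (\<Sum>w\<in>V. \<Sum>i<d. \<Sum>w'\<in>V. \<Sum>i'<d. if i = i' then (inc w * p w i) * (inc w' * p w' i') else 0)"
    by (simp add: sum.cartesian_product' case_prod_beta mult_ac if_distrib[of "\<lambda>x. x * _"] if_distrib[of "\<lambda>x. _ * x"] cong: if_cong)
  also have "\<dots> = (\<Sum>w\<in>V. \<Sum>i<d. \<Sum>w'\<in>V. (inc w * p w i) * (inc w' * p w' i))"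
    by simp
  also have "\<dots> = (\<Sum>i<d. \<Sum>w\<in>V. \<Sum>w'\<in>V. (inc w * p w i) * (inc w' * p w' i))"
    by (rule sum.swap)
  also have "\<dots> = (\<Sum>i<d. (\<Sum>w\<in>V. inc w * p w i) * (\<Sum>w'\<in>V. inc w' * p w' i))"
    by (simp only: sum_product)
  also have "\<dots> = (\<Sum>i<d. (p u i - p v i)\<^sup>2)"
    unfolding inc by (simp add: power2_eq_square)
  also have "\<dots> = (edist d (p u) (p v))\<^sup>2"
    unfolding edist_def L2_set_def by (simp add: sum_nonneg)
  finally show ?thesis .
qed

lemma rank_of_bijection:
  assumes "bij_betw g E {..<m}" "e \<in> E"
  shows "card {f \<in> E. g f < g e} = (g e :: nat)"
proof -
  have "g ` {f \<in> E. g f < g e} = {..<g e}"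
  proof (intro equalityI subsetI)
    fix k assume k: "k \<in> {..<g e}"
    have "g e < m" using assms by (auto simp: bij_betw_def)
    then have "k \<in> g ` E" using k assms(1) by (auto simp: bij_betw_def)
    then show "k \<in> g ` {f \<in> E. g f < g e}" using k by auto
  qed auto
  moreover have "inj_on g {f \<in> E. g f < g e}"
    by (rule inj_on_subset[OF bij_betw_imp_inj_on[OF assms(1)]]) auto
  ultimately show ?thesis by (metis card_image card_lessThan)
qed

lemma card_ordered_pairs_le:
  fixes h :: "'e \<Rightarrow> nat"
  assumes "finite E"
  shows "2 * card {(e, f) \<in> E \<times> E. h e < h f} \<le> card E * card E"
proof -
  let ?S = "{(e, f) \<in> E \<times> E. h e < h f}"
  have "card (prod.swap ` ?S) = card ?S" by (intro card_image) auto
  moreover have finS: "finite ?S" by (rule finite_subset[of _ "E \<times> E"]) (use assms in auto)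
  moreover have "?S \<inter> prod.swap ` ?S = {}" by auto
  ultimately have "card (?S \<union> prod.swap ` ?S) = 2 * card ?S"
    by (subst card_Un_disjoint) auto
  moreover have "card (?S \<union> prod.swap ` ?S) \<le> card (E \<times> E)"
    using assms by (intro card_mono) auto
  ultimately show ?thesis by (simp add: card_cartesian_product)
qed

text \<open>Every permutation \<open>\<pi>\<close> of the edges induces an order, comparing the positions of
\<open>\<pi> e\<close> in a fixed enumeration \<open>h\<close>. A realization is a point whose sign pattern for the
differences of squared lengths encodes this order, and the order determines \<open>\<pi>\<close>. Each
unordered pair of edges contributes only one difference; counting ordered pairs would double the
number of polynomials, which would spoil the constant in the final bound.\<close>

lemma fact_le_patterns:
  fixes V :: "'v set"
  assumes G: "simple_graph V E" and orders: "all_orders_realizable d V E"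
  shows "\<exists>S (Q :: 'v set \<times> 'v set \<Rightarrow> _). finite S \<and> 2 * card S \<le> card E * card E \<and>
    fact (card E) \<le> card (patterns (V \<times> {..<d}) S Q (\<lambda>_ _. 0) (\<lambda>_. 0))"
proof -
  have finV: "finite V" and E: "\<And>e. e \<in> E \<Longrightarrow> e \<subseteq> V \<and> card e = 2"
    using G by (auto simp: simple_graph_def)
  have finE: "finite E" by (rule finite_subset[of _ "Pow V"]) (use finV E in auto)
  let ?m = "card E"
  obtain h where "bij_betw h E {0..<?m}" using ex_bij_betw_finite_nat[OF finE] by blast
  then have h: "bij_betw h E {..<?m}" by (simp add: atLeast0LessThan)
  have "\<forall>e\<in>E. \<exists>uv. e = {fst uv, snd uv} \<and> fst uv \<noteq> snd uv"
    using E by (force simp: card_2_iff)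
  from bchoice[OF this] obtain en where en: "\<forall>e\<in>E. e = {fst (en e), snd (en e)} \<and> fst (en e) \<noteq> snd (en e)"
    by (elim exE)
  let ?u = "\<lambda>e. fst (en e)" and ?v = "\<lambda>e. snd (en e)"
  have in_V: "?u e \<in> V" "?v e \<in> V" "?u e \<noteq> ?v e" if "e \<in> E" for e
    using that E[OF that] en by blast+
  define inc where "inc e w = (if w = ?u e then 1 else 0) - (if w = ?v e then 1 else (0::real))" for e w
  define D where "D e k l = (if snd k = snd l then inc e (fst k) * inc e (fst l) else 0)"
    for e and k l :: "'v \<times> nat"
  define Q where "Q ef k l = D (fst ef) k l - D (snd ef) k l" for ef k l
  define S where "S = {(e, f) \<in> E \<times> E. h e < h f}"
  let ?I = "V \<times> {..<d}"
  have finS: "finite S" unfolding S_def by (rule finite_subset[of _ "E \<times> E"]) (use finE in auto)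
  have quad: "quad ?I (Q (e, f)) (\<lambda>_. 0) (\<lambda>k. p (fst k) (snd k))
      = (edist d (p (?u e)) (p (?v e)))\<^sup>2 - (edist d (p (?u f)) (p (?v f)))\<^sup>2"
    if "e \<in> E" "f \<in> E" for e f p
    using edist_as_quad[OF finV in_V[OF that(1)], where p = p and d = d]
      edist_as_quad[OF finV in_V[OF that(2)], where p = p and d = d]
    unfolding quad_def Q_def D_def inc_def fst_conv snd_conv
    by (simp add: left_diff_distrib sum_subtractf)
  define P where "P \<pi> = {(e, f) \<in> S. h (\<pi> f) < h (\<pi> e)}" for \<pi>
  have P_in: "P \<pi> \<in> patterns ?I S Q (\<lambda>_ _. 0) (\<lambda>_. 0)" if \<pi>: "\<pi> permutes E" for \<pi>
  proof -
    define r where "r = {(e, f) \<in> E \<times> E. h (\<pi> e) \<le> h (\<pi> f)}"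
    have inj: "e = f" if "e \<in> E" "f \<in> E" "h (\<pi> e) = h (\<pi> f)" for e f
    proof -
      have "\<pi> e = \<pi> f"
        using that permutes_in_image[OF \<pi>] bij_betw_imp_inj_on[OF h] by (meson inj_onD)
      then show ?thesis using permutes_inj[OF \<pi>] by (meson injD)
    qed
    have "linear_order_on E r"
      unfolding linear_order_on_def partial_order_on_def preorder_on_def refl_on_def trans_def
        antisym_def total_on_def r_def
      using inj by auto
    then have "realizable d V E r" using orders by (simp add: all_orders_realizable_def)
    then obtain p where p: "\<forall>u v x y. {u, v} \<in> E \<and> {x, y} \<in> E \<and> {u, v} \<noteq> {x, y} \<longrightarrow>
           edist d (p u) (p v) \<noteq> edist d (p x) (p y) \<and>
           (({u, v}, {x, y}) \<in> r \<longleftrightarrow> edist d (p u) (p v) < edist d (p x) (p y))"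
      unfolding realizable_def by (elim exE conjE)
    let ?l = "\<lambda>e. edist d (p (?u e)) (p (?v e))"
    have l: "?l e \<noteq> ?l f \<and> ((e, f) \<in> r \<longleftrightarrow> ?l e < ?l f)" if "e \<in> E" "f \<in> E" "e \<noteq> f" for e f
    proof -
      have "e = {?u e, ?v e}" "f = {?u f, ?v f}" using en that by blast+
      then show ?thesis using p[rule_format, of "?u e" "?v e" "?u f" "?v f"] that by simp
    qed
    have sq: "?l e ^ 2 < ?l f ^ 2 \<longleftrightarrow> ?l e < ?l f" for e f
      unfolding edist_def
      by (auto intro: power2_less_imp_less power_strict_mono simp: L2_set_nonneg)
    let ?x = "\<lambda>k. p (fst k) (snd k)"
    have S: "quad ?I (Q ef) (\<lambda>_. 0) ?x \<noteq> 0 \<and> (0 < quad ?I (Q ef) (\<lambda>_. 0) ?x \<longleftrightarrow> ef \<in> P \<pi>)"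
      if efS: "ef \<in> S" for ef
    proof -
      obtain e f where ef: "ef = (e, f)" "e \<in> E" "f \<in> E" "h e < h f"
        using efS unfolding S_def by auto
      then have ne: "e \<noteq> f" by auto
      have "ef \<in> P \<pi> \<longleftrightarrow> \<not> h (\<pi> e) \<le> h (\<pi> f)" using efS ef(1) by (auto simp: P_def)
      also have "\<dots> \<longleftrightarrow> (e, f) \<notin> r" using ef by (auto simp: r_def)
      also have "\<dots> \<longleftrightarrow> ?l f < ?l e" using l[OF ef(2,3) ne] by linarith
      finally have "ef \<in> P \<pi> \<longleftrightarrow> ?l f ^ 2 < ?l e ^ 2" unfolding sq .
      moreover have "?l e ^ 2 \<noteq> ?l f ^ 2" using l[OF ef(2,3) ne] sq[of e f] sq[of f e] by linarith
      ultimately show ?thesis unfolding ef(1) quad[OF ef(2,3)] by simp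
    qed
    have "P \<pi> = {ef \<in> S. 0 < quad ?I (Q ef) (\<lambda>_. 0) ?x}" using S unfolding P_def by blast
    moreover have "\<forall>ef\<in>S. quad ?I (Q ef) (\<lambda>_. 0) ?x \<noteq> 0" using S by blast
    ultimately show ?thesis unfolding patterns_def by blast
  qed
  have inj: "inj_on P {\<pi>. \<pi> permutes E}"
  proof (rule inj_onI)
    fix \<pi> \<rho> assume \<pi>: "\<pi> \<in> {\<pi>. \<pi> permutes E}" and \<rho>: "\<rho> \<in> {\<pi>. \<pi> permutes E}" and eq: "P \<pi> = P \<rho>"
    have bij: "bij_betw (\<lambda>e. h (\<pi>' e)) E {..<?m}" if "\<pi>' permutes E" for \<pi>'
      using bij_betw_trans[OF permutes_imp_bij[OF that] h] by (simp add: comp_def)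
    have cmp: "h (\<pi> f) < h (\<pi> e) \<longleftrightarrow> h (\<rho> f) < h (\<rho> e)" if "e \<in> E" "f \<in> E" for e f
    proof (cases "h e" "h f" rule: linorder_cases)
      case less
      then have "(e, f) \<in> S" using that by (simp add: S_def)
      then show ?thesis using eq unfolding P_def by blast
    next
      case equal
      then have "e = f" using that bij_betw_imp_inj_on[OF h] by (meson inj_onD)
      then show ?thesis by simp
    next
      case greater
      then have fe: "(f, e) \<in> S" using that by (simp add: S_def)
      then have "h (\<pi> e) < h (\<pi> f) \<longleftrightarrow> h (\<rho> e) < h (\<rho> f)" using eq unfolding P_def by blast
      moreover have "h (\<pi>' e) \<noteq> h (\<pi>' f)" if "\<pi>' permutes E" for \<pi>'
        using bij_betw_imp_inj_on[OF bij[OF that]] greater \<open>e \<in> E\<close> \<open>f \<in> E\<close> by (metis inj_onD less_irrefl)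
      ultimately show ?thesis using \<pi> \<rho> by (metis linorder_less_linear mem_Collect_eq order_less_asym)
    qed
    show "\<pi> = \<rho>"
    proof
      fix e show "\<pi> e = \<rho> e"
      proof (cases "e \<in> E")
        case True
        have rank: "card {f \<in> E. h (\<pi>' f) < h (\<pi>' e)} = h (\<pi>' e)" if "\<pi>' permutes E" for \<pi>'
          by (rule rank_of_bijection[OF bij[OF that] True])
        have "h (\<pi> e) = card {f \<in> E. h (\<pi> f) < h (\<pi> e)}" using rank[of \<pi>] \<pi> by simp
        also have "{f \<in> E. h (\<pi> f) < h (\<pi> e)} = {f \<in> E. h (\<rho> f) < h (\<rho> e)}"
          using cmp[OF True] by blast
        also have "card \<dots> = h (\<rho> e)" using rank[of \<rho>] \<rho> by simp
        finally have "h (\<pi> e) = h (\<rho> e)" .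
        moreover have "\<pi> e \<in> E" "\<rho> e \<in> E"
          using True \<pi> \<rho> by (simp_all add: permutes_in_image)
        ultimately show ?thesis by (rule inj_onD[OF bij_betw_imp_inj_on[OF h]])
      next
        case False
        then show ?thesis using \<pi> \<rho> by (simp add: permutes_def)
      qed
    qed
  qed
  have "fact ?m = card (P ` {\<pi>. \<pi> permutes E})"
    using card_permutations[OF refl finE] card_image[OF inj] by simp
  also have "\<dots> \<le> card (patterns ?I S Q (\<lambda>_ _. 0) (\<lambda>_. 0))"
    by (rule card_mono[OF finite_patterns[OF finS]]) (use P_in in auto)
  finally have "fact ?m \<le> card (patterns ?I S Q (\<lambda>_ _. 0) (\<lambda>_. 0))" .
  moreover have "2 * card S \<le> ?m * ?m" unfolding S_def by (rule card_ordered_pairs_le[OF finE])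
  ultimately show ?thesis using finS by blast
qed

lemma fact_lower_bound: "real m ^ m / exp (real m) \<le> fact m"
proof -
  have "(\<lambda>n. real m ^ n /\<^sub>R fact n) sums exp (real m)" by (rule exp_converges)
  then have s: "summable (\<lambda>n. real m ^ n /\<^sub>R fact n)" "exp (real m) = (\<Sum>n. real m ^ n /\<^sub>R fact n)"
    by (simp_all add: sums_iff)
  have "sum (\<lambda>n. real m ^ n /\<^sub>R fact n) {m} \<le> exp (real m)"
    unfolding s(2) by (rule sum_le_suminf[OF s(1)]) auto
  then show ?thesis by (simp add: field_simps)
qed

text \<open>For \<open>m > N\<close> write \<open>m = N * (1 + \<delta>)\<close>, \<open>L = ln N\<close> and \<open>u = ln (1 + \<delta>)\<close>. Taking
logarithms, with \<open>m ^ m / exp m \<le> fact m\<close>, and dividing by \<open>N\<close> turns the hypothesis into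
\<open>\<delta> * (L + u - 1) \<le> A + u\<close> for \<open>A = 2 + 2 * ln 2\<close>. As \<open>0 \<le> u \<le> \<delta>\<close>,
it follows that \<open>\<delta> * (L - 2) \<le> A\<close>, which yields the stated expansion for large
\<open>L\<close>. For \<open>L < 4\<close> the inequality still gives \<open>\<delta> < 8\<close>, which is below
\<open>128 / L\<^sup>2\<close> and so is absorbed by the last term.\<close>

lemma fact_le_implies_near_linear:
  fixes m N :: nat
  assumes N: "N \<ge> 2" and le: "m > N \<Longrightarrow> fact m \<le> (4 * exp 1 * real m ^ 2 / real N) ^ N"
  shows "real m \<le> real N + (2 + 2 * ln 2) * (real N / ln (real N)) + 128 * (real N / (ln (real N))\<^sup>2)"
proof (cases "m > N")
  case False
  then have "real m \<le> real N" by simp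
  moreover have "ln (real N) > 0" using N by simp
  moreover have "2 + 2 * ln 2 > (0::real)" by (simp add: add_pos_pos)
  ultimately show ?thesis by (simp add: add_increasing2)
next
  case True
  define L where "L = ln (real N)"
  define \<delta> where "\<delta> = (real m - real N) / real N"
  define u where "u = ln (1 + \<delta>)"
  define A where "A = 2 + 2 * ln (2::real)"
  have Npos: "real N > 0" and mpos: "real m > 0" using N True by auto
  have \<delta>: "\<delta> > 0" unfolding \<delta>_def using True Npos by simp
  have m: "real m = real N * (1 + \<delta>)" unfolding \<delta>_def using Npos by (simp add: field_simps)
  have L: "L > 0" unfolding L_def using N by simp
  have u: "0 \<le> u" "u \<le> \<delta>" unfolding u_def using \<delta> by (auto intro: ln_add_one_self_le_self)
  have A: "0 < A" "A \<le> 4" unfolding A_def using ln_le_minus_one[of 2] by (auto simp: add_pos_pos)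
  have lnm: "ln (real m) = L + u" unfolding m L_def u_def using Npos \<delta> by (simp add: ln_mult)
  have "real m ^ m / exp (real m) \<le> (4 * exp 1 * real m ^ 2 / real N) ^ N"
    using fact_lower_bound[of m] le[OF True] by linarith
  then have "ln (real m ^ m / exp (real m)) \<le> ln ((4 * exp 1 * real m ^ 2 / real N) ^ N)"
    using mpos by (intro ln_mono) auto
  moreover have "ln (real m ^ m / exp (real m)) = real m * (L + u) - real m"
    using mpos by (simp add: ln_div ln_realpow lnm)
  moreover have "ln ((4 * exp 1 * real m ^ 2 / real N) ^ N) = real N * (2 * ln 2 + 1 + 2 * (L + u) - L)"
  proof -
    have "ln (4::real) = 2 * ln 2" using ln_realpow[of 2 2] by simp
    then have "ln (4 * exp 1 * real m ^ 2 / real N) = 2 * ln 2 + 1 + 2 * (L + u) - L"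
      using mpos Npos by (simp add: ln_div ln_mult ln_realpow lnm L_def)
    then show ?thesis using mpos Npos by (simp add: ln_realpow)
  qed
  ultimately have "real N * ((1 + \<delta>) * (L + u) - (1 + \<delta>)) \<le> real N * (2 * ln 2 + 1 + 2 * (L + u) - L)"
    by (simp add: m algebra_simps)
  then have "(1 + \<delta>) * (L + u) - (1 + \<delta>) \<le> 2 * ln 2 + 1 + 2 * (L + u) - L"
    using Npos by simp
  then have main: "\<delta> * (L + u - 1) \<le> A + u" unfolding A_def by (simp add: algebra_simps)
  have "\<delta> \<le> A / L + 128 / L\<^sup>2"
  proof (cases "L \<ge> 4")
    case True
    have "0 \<le> \<delta> * u" using u \<delta> by simp
    moreover have "\<delta> * (L + u - 1) = \<delta> * (L - 2) + \<delta> + \<delta> * u" by (simp add: algebra_simps)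
    ultimately have "\<delta> * (L - 2) \<le> A" using main u(2) by linarith
    then have "\<delta> \<le> A / (L - 2)" using True by (simp add: pos_le_divide_eq)
    also have "\<dots> \<le> A / L + 4 * A / L\<^sup>2"
    proof -
      have "A / (L - 2) - A / L = 2 * A / (L * (L - 2))" using True by (simp add: field_simps)
      also have "\<dots> \<le> 2 * A / (L * (L / 2))"
        using True A by (intro divide_left_mono mult_left_mono) auto
      also have "\<dots> = 4 * A / L\<^sup>2" by (simp add: power2_eq_square)
      finally show ?thesis by simp
    qed
    also have "4 * A / L\<^sup>2 \<le> 128 / L\<^sup>2" using A L by (intro divide_right_mono) auto
    finally show ?thesis by simp
  next
    case False
    have "\<delta> < 8"
    proof (rule ccontr)
      assume "\<not> \<delta> < 8"
      then have d8: "\<delta> \<ge> 8" by simp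
      have "exp (2::real) = exp 1 * exp 1" by (simp flip: exp_add)
      also have "\<dots> \<le> 3 * 3" using exp_le by (intro mult_mono) auto
      finally have "exp 2 \<le> 1 + \<delta>" using d8 by simp
      then have u2: "u \<ge> 2" unfolding u_def using \<delta> by (simp add: ln_ge_iff)
      have "8 * (u - 1) \<le> \<delta> * (L + u - 1)" using d8 u2 L by (intro mult_mono) auto
      then have "8 * (u - 1) \<le> A + u" using main by (rule order_trans)
      then show False using u2 A by simp
    qed
    moreover have "128 / L\<^sup>2 \<ge> 8"
    proof -
      have "L\<^sup>2 \<le> 4\<^sup>2" using False L by (intro power_mono) auto
      then show ?thesis using L by (simp add: pos_le_divide_eq)
    qed
    moreover have "A / L \<ge> 0" using A L by simp
    ultimately show ?thesis by linarith
  qed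
  then have "real N * \<delta> \<le> real N * (A / L + 128 / L\<^sup>2)" using Npos by simp
  moreover have "real N * (A / L + 128 / L\<^sup>2) = A * (real N / L) + 128 * (real N / L\<^sup>2)"
    by (simp add: distrib_left mult.commute)
  moreover have "real m = real N + real N * \<delta>" unfolding m by (simp add: distrib_left)
  ultimately show ?thesis unfolding A_def[symmetric] L_def[symmetric] by simp
qed

theorem card_edges_upper_bound:
  assumes G: "simple_graph V E" and orders: "all_orders_realizable d V E"
    and N: "d * card V \<ge> 2"
  shows "real (card E) \<le> real (d * card V) + (2 + 2 * ln 2) * (real (d * card V) / ln (real (d * card V)))
    + 128 * (real (d * card V) / (ln (real (d * card V)))\<^sup>2)"
proof (rule fact_le_implies_near_linear[OF N])
  let ?m = "card E" and ?N = "d * card V"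
  assume m: "?m > ?N"
  obtain S and Q :: "'a set \<times> 'a set \<Rightarrow> _" where S: "finite S" "2 * card S \<le> ?m * ?m"
    and f: "fact ?m \<le> card (patterns (V \<times> {..<d}) S Q (\<lambda>_ _. 0) (\<lambda>_. 0))"
    using fact_le_patterns[OF G orders] by blast
  have finI: "finite (V \<times> {..<d})" using G by (simp add: simple_graph_def)
  have cI: "card (V \<times> {..<d}) = ?N" by (simp add: card_cartesian_product mult.commute)
  have "fact ?m \<le> (\<Sum>J | J \<subseteq> S \<and> card J \<le> ?N. 2 ^ ?N * 4 ^ card J :: nat)"
    using f card_patterns[OF finI S(1), of Q "\<lambda>_ _. 0" "\<lambda>_. 0"] unfolding cI by (rule order_trans)
  then have "real (fact ?m) \<le> real (\<Sum>J | J \<subseteq> S \<and> card J \<le> ?N. 2 ^ ?N * 4 ^ card J)"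
    unfolding of_nat_le_iff .
  also have "\<dots> = (\<Sum>J | J \<subseteq> S \<and> card J \<le> ?N. 2 ^ ?N * 4 ^ card J)" by simp
  also have "\<dots> \<le> (8 * exp 1 * (real ?m ^ 2 / 2) / real ?N) ^ ?N"
  proof (rule sum_small_subsets_le[OF S(1)])
    have "real (2 * card S) \<le> real (?m * ?m)" using S(2) by (rule of_nat_mono)
    then show "real (card S) \<le> real ?m ^ 2 / 2" by (simp add: power2_eq_square)
    have "2 * ?N \<le> ?m * ?m" using m N by (intro mult_le_mono) auto
    then have "real (2 * ?N) \<le> real (?m * ?m)" by (rule of_nat_mono)
    then show "real ?N \<le> real ?m ^ 2 / 2" by (simp add: power2_eq_square)
    show "1 \<le> ?N" using N by linarith
  qed
  finally show "fact ?m \<le> (4 * exp 1 * real ?m ^ 2 / real ?N) ^ ?N"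
    by (simp add: mult.assoc)
qed

section \<open>A graph with all orders realizable\<close>

text \<open>All edges have the same length in the configuration \<open>p\<close>, so after a small displacement along
\<open>w\<close> the order of the lengths is that of their first-order changes, provided that these are
distinct. Points of \<open>p\<close> may coincide: two vertices are separated after the displacement if
they are adjacent, or if they have a common neighbour, to which their distances differ.\<close>

lemma realizable_of_first_order:
  fixes p w :: "'v \<Rightarrow> nat \<Rightarrow> real" and \<rho> :: "'v set \<Rightarrow> real"
  assumes G: "simple_graph V E" and c: "c > 0"
    and base: "\<And>u v. {u, v} \<in> E \<Longrightarrow> (\<Sum>k<d. (p u k - p v k)\<^sup>2) = c"
    and first: "\<And>u v. {u, v} \<in> E \<Longrightarrow> (\<Sum>k<d. (p u k - p v k) * (w u k - w v k)) = \<rho> {u, v}"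
    and ord: "\<And>e f. e \<in> E \<Longrightarrow> f \<in> E \<Longrightarrow> e \<noteq> f \<Longrightarrow> \<rho> e \<noteq> \<rho> f \<and> ((e, f) \<in> r \<longleftrightarrow> \<rho> e < \<rho> f)"
    and sep: "\<And>u v. u \<in> V \<Longrightarrow> v \<in> V \<Longrightarrow> u \<noteq> v \<Longrightarrow> {u, v} \<in> E \<or> (\<exists>x. {u, x} \<in> E \<and> {v, x} \<in> E)"
    and supp: "\<And>v k. k \<ge> d \<Longrightarrow> p v k = 0 \<and> w v k = 0"
  shows "realizable d V E r"
proof -
  have finV: "finite V" and in_V: "\<And>u v. {u, v} \<in> E \<Longrightarrow> u \<in> V \<and> v \<in> V"
    using G by (auto simp: simple_graph_def)
  let ?q = "\<lambda>t v k. p v k + t * w v k"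
  define B where "B u v = (\<Sum>k<d. (w u k - w v k)\<^sup>2)" for u v
  have sq: "(edist d (?q t u) (?q t v))\<^sup>2 = c + t * (2 * \<rho> {u, v}) + t\<^sup>2 * B u v" if "{u, v} \<in> E" for t u v
  proof -
    have "(edist d (?q t u) (?q t v))\<^sup>2 = (\<Sum>k<d. (?q t u k - ?q t v k)\<^sup>2)"
      unfolding edist_def L2_set_def by (simp add: sum_nonneg)
    also have "\<dots> = (\<Sum>k<d. (p u k - p v k)\<^sup>2 + t * (2 * ((p u k - p v k) * (w u k - w v k)))
        + t\<^sup>2 * (w u k - w v k)\<^sup>2)"
      by (intro sum.cong refl) (simp add: power2_eq_square algebra_simps)
    also have "\<dots> = (\<Sum>k<d. (p u k - p v k)\<^sup>2) + t * (2 * (\<Sum>k<d. (p u k - p v k) * (w u k - w v k)))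
        + t\<^sup>2 * (\<Sum>k<d. (w u k - w v k)\<^sup>2)"
      by (simp only: sum.distrib sum_distrib_left)
    finally show ?thesis unfolding base[OF that] first[OF that] B_def .
  qed
  let ?V2 = "V \<times> V"
  have "eventually (\<lambda>t. \<forall>a\<in>?V2. \<forall>b\<in>?V2. \<rho> {fst a, snd a} < \<rho> {fst b, snd b} \<longrightarrow>
      0 + t * (2 * \<rho> {fst b, snd b} - 2 * \<rho> {fst a, snd a}) + t\<^sup>2 * (B (fst b) (snd b) - B (fst a) (snd a)) > 0)
      (at_right 0)"
  proof (intro eventually_ball_finite ballI)
    fix a b assume "a \<in> ?V2" "b \<in> ?V2"
    show "eventually (\<lambda>t. \<rho> {fst a, snd a} < \<rho> {fst b, snd b} \<longrightarrow>
      0 + t * (2 * \<rho> {fst b, snd b} - 2 * \<rho> {fst a, snd a}) + t\<^sup>2 * (B (fst b) (snd b) - B (fst a) (snd a)) > 0)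
      (at_right 0)"
    proof (cases "\<rho> {fst a, snd a} < \<rho> {fst b, snd b}")
      case True
      then show ?thesis
        using eventually_quadratic_pos[of 0 "2 * \<rho> {fst b, snd b} - 2 * \<rho> {fst a, snd a}"] by simp
    qed simp
  qed (use finV in auto)
  moreover have "eventually (\<lambda>t. \<forall>a\<in>?V2. c + t * (2 * \<rho> {fst a, snd a}) + t\<^sup>2 * B (fst a) (snd a) > 0) (at_right 0)"
    by (intro eventually_ball_finite ballI eventually_quadratic_pos) (use finV c in auto)
  ultimately have "eventually (\<lambda>t. (\<forall>a\<in>?V2. \<forall>b\<in>?V2. \<rho> {fst a, snd a} < \<rho> {fst b, snd b} \<longrightarrow>
      0 + t * (2 * \<rho> {fst b, snd b} - 2 * \<rho> {fst a, snd a}) + t\<^sup>2 * (B (fst b) (snd b) - B (fst a) (snd a)) > 0)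
      \<and> (\<forall>a\<in>?V2. c + t * (2 * \<rho> {fst a, snd a}) + t\<^sup>2 * B (fst a) (snd a) > 0)) (at_right (0::real))"
    by (rule eventually_conj)
  from eventually_happens[OF this]
  obtain t :: real where t: "\<forall>a\<in>?V2. \<forall>b\<in>?V2. \<rho> {fst a, snd a} < \<rho> {fst b, snd b} \<longrightarrow>
      0 + t * (2 * \<rho> {fst b, snd b} - 2 * \<rho> {fst a, snd a}) + t\<^sup>2 * (B (fst b) (snd b) - B (fst a) (snd a)) > 0"
    "\<forall>a\<in>?V2. c + t * (2 * \<rho> {fst a, snd a}) + t\<^sup>2 * B (fst a) (snd a) > 0"
    by auto
  let ?l = "\<lambda>u v. edist d (?q t u) (?q t v)"
  have pos: "?l u v \<noteq> 0" if "{u, v} \<in> E" for u v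
  proof -
    have "c + t * (2 * \<rho> {u, v}) + t\<^sup>2 * B u v > 0" using t(2) in_V[OF that] by force
    then show ?thesis using sq[OF that, of t] by force
  qed
  have less: "?l u v < ?l x y" if "{u, v} \<in> E" "{x, y} \<in> E" "\<rho> {u, v} < \<rho> {x, y}" for u v x y
  proof -
    have "(u, v) \<in> ?V2" "(x, y) \<in> ?V2" using in_V that by auto
    from t(1)[rule_format, OF this] have
      "0 + t * (2 * \<rho> {x, y} - 2 * \<rho> {u, v}) + t\<^sup>2 * (B x y - B u v) > 0" using that(3) by simp
    then have "(?l u v)\<^sup>2 < (?l x y)\<^sup>2"
      unfolding sq[OF that(1)] sq[OF that(2)] by (simp add: algebra_simps)
    then show ?thesis by (rule power2_less_imp_less) (simp add: edist_def L2_set_nonneg)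
  qed
  have main: "?l u v \<noteq> ?l x y \<and> (({u, v}, {x, y}) \<in> r \<longleftrightarrow> ?l u v < ?l x y)"
    if "{u, v} \<in> E" "{x, y} \<in> E" "{u, v} \<noteq> {x, y}" for u v x y
    using ord[OF that] less[OF that(1,2)] less[OF that(2,1)] by force
  have inj: "inj_on (?q t) V"
  proof (rule inj_onI, rule ccontr)
    fix u v assume uv: "u \<in> V" "v \<in> V" "?q t u = ?q t v" "u \<noteq> v"
    from sep[OF uv(1,2,4)] show False
    proof
      assume "{u, v} \<in> E"
      from pos[OF this] show False unfolding uv(3) by (simp add: edist_def L2_set_def)
    next
      assume "\<exists>x. {u, x} \<in> E \<and> {v, x} \<in> E"
      then obtain x where x: "{u, x} \<in> E" "{v, x} \<in> E" by blast
      have "{u, x} \<noteq> {v, x}" using uv(4) by (auto simp: doubleton_eq_iff)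
      from main[OF x this] show False unfolding uv(3) by simp
    qed
  qed
  have "?q t \<in> V \<rightarrow> topspace (Euclidean_space d)"
    using supp by (auto simp: topspace_Euclidean_space)
  then show ?thesis unfolding realizable_def using inj main by (intro exI[of _ "?q t"]) blast
qed

definition order_rank :: "'e set \<Rightarrow> 'e rel \<Rightarrow> 'e \<Rightarrow> real" where
  "order_rank E r e = real (card {f \<in> E. (f, e) \<in> r})"

lemma order_rank_less:
  assumes lin: "linear_order_on E r" and fin: "finite E"
    and ef: "e \<in> E" "f \<in> E" "e \<noteq> f" "(e, f) \<in> r"
  shows "order_rank E r e < order_rank E r f"
proof -
  have tr: "trans r" and as: "antisym r" and rf: "refl_on E r"
    using lin by (auto simp: linear_order_on_def partial_order_on_def preorder_on_def)
  have "{g \<in> E. (g, e) \<in> r} \<subset> {g \<in> E. (g, f) \<in> r}"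
  proof
    show "{g \<in> E. (g, e) \<in> r} \<subseteq> {g \<in> E. (g, f) \<in> r}" using tr ef(4) by (auto dest: transD)
    have "(f, f) \<in> r" using rf ef(2) by (auto dest: refl_onD)
    moreover have "(f, e) \<notin> r" using as ef(3,4) by (auto dest: antisymD)
    ultimately show "{g \<in> E. (g, e) \<in> r} \<noteq> {g \<in> E. (g, f) \<in> r}" using ef(2) by blast
  qed
  then show ?thesis unfolding order_rank_def using fin by (simp add: psubset_card_mono)
qed

lemma order_rank_iff:
  assumes lin: "linear_order_on E r" and fin: "finite E"
    and ef: "e \<in> E" "f \<in> E" "e \<noteq> f"
  shows "order_rank E r e \<noteq> order_rank E r f \<and> ((e, f) \<in> r \<longleftrightarrow> order_rank E r e < order_rank E r f)"
proof -
  have "(e, f) \<in> r \<or> (f, e) \<in> r"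
    using lin ef by (auto simp: linear_order_on_def total_on_def)
  then show ?thesis
    using order_rank_less[OF lin fin ef] order_rank_less[OF lin fin ef(2,1) ef(3)[symmetric]] by force
qed

text \<open>The first \<open>d\<close> vertices form a clique and are joined to all others, which are pairwise
nonadjacent; for \<open>n \<le> d\<close> this is the complete graph on \<open>n\<close> vertices.\<close>

definition clique_join :: "nat \<Rightarrow> nat \<Rightarrow> nat set set" where
  "clique_join d n = (\<lambda>(i, j). {j, i}) ` (SIGMA i:{..<n}. {..<min i d})"

lemma clique_join_iff: "{j, i} \<in> clique_join d n" if "j < i" "i < n" "j < d"
  using that unfolding clique_join_def by (intro image_eqI[of _ _ "(i, j)"]) auto

lemma clique_joinE:
  assumes "{u, v} \<in> clique_join d n"
  obtains "u < v" "v < n" "u < d" | "v < u" "u < n" "v < d"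
  using assms unfolding clique_join_def by (force simp: doubleton_eq_iff)

text \<open>Vertex \<open>i\<close> has \<open>min i d\<close> smaller neighbours, which falls short of \<open>d\<close> by
\<open>d - i\<close> in truncated subtraction.\<close>

lemma card_clique_join: "real (d * n) - real ((d + 1) choose 2) \<le> real (card (clique_join d n))"
proof -
  have "inj_on (\<lambda>(i, j). {j, i}) (SIGMA i:{..<n}. {..<min i d})"
    by (auto simp: inj_on_def doubleton_eq_iff)
  then have "card (clique_join d n) = (\<Sum>i<n. min i d)"
    unfolding clique_join_def by (simp add: card_image)
  moreover have "d * n = (\<Sum>i<n. min i d + (d - i))"
  proof -
    have "min i d + (d - i) = d" for i by simp
    then show ?thesis by (simp only: sum_constant card_lessThan of_nat_id mult.commute)
  qed
  moreover have "(\<Sum>i<n. d - i) \<le> (d + 1) choose 2"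
  proof -
    have "(\<Sum>i<n. d - i) = (\<Sum>i\<in>{..<n} \<inter> {..d}. d - i)" by (intro sum.mono_neutral_right) auto
    also have "\<dots> \<le> (\<Sum>i\<le>d. d - i)" by (intro sum_mono2) auto
    also have "\<dots> = (\<Sum>i\<le>d. i)" by (rule sum.reindex_bij_witness[of _ "\<lambda>i. d - i" "\<lambda>i. d - i"]) auto
    also have "\<dots> = (d + 1) choose 2" by (simp add: choose_two gauss_sum_nat atMost_atLeast0 mult.commute)
    finally show ?thesis .
  qed
  ultimately have "d * n \<le> card (clique_join d n) + ((d + 1) choose 2)" by (simp add: sum.distrib)
  then have "real (d * n) \<le> real (card (clique_join d n) + ((d + 1) choose 2))" by (rule of_nat_mono)
  then show ?thesis by simp
qed

lemma simple_graph_clique_join: "simple_graph {..<n} (clique_join d n)"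
  by (auto simp: simple_graph_def clique_join_def)

text \<open>In the configuration \<open>p\<close> the clique sits at the unit vectors and all other vertices sit at the
point with all coordinates equal to \<open>s\<close>, where \<open>s\<close> is chosen so that all edges have
squared length \<open>2\<close>. Displacements with prescribed first-order changes are found by treating
the vertices in increasing order: the changes at the edges from \<open>v\<close> to its smaller neighbours
are linear in the displacement of \<open>v\<close>. For \<open>v < d\<close> the system is diagonal. For
\<open>v \<ge> d\<close> its matrix is \<open>s\<close> times the all-ones matrix minus the identity, whose solution
is expressed through \<open>T v\<close>, the sum of the coordinates of the displacement.\<close>

lemma clique_join_all_orders:
  assumes d: "d \<ge> 1"
  shows "all_orders_realizable d {..<n} (clique_join d n)"
  unfolding all_orders_realizable_def
proof (intro allI impI)
  fix r assume lin: "linear_order_on (clique_join d n) r"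
  let ?E = "clique_join d n"
  define \<rho> where "\<rho> = order_rank ?E r"
  \<comment> \<open>The positive root of \<open>d * s\<^sup>2 - 2 * s - 1\<close>.\<close>
  define s where "s = (1 + sqrt (1 + real d)) / real d"
  have ds: "real d * s - 1 = sqrt (1 + real d)" using d by (simp add: s_def)
  have s: "real d * s\<^sup>2 - 2 * s + 1 = 2"
  proof -
    have "(real d * s - 1)\<^sup>2 = 1 + real d" unfolding ds by simp
    then have "real d * (real d * s\<^sup>2 - 2 * s - 1) = 0" by (simp add: power2_eq_square algebra_simps)
    then show ?thesis using d by simp
  qed
  define p where "p v k = (if k < d then if v < d then if k = v then 1 else 0 else s else 0)" for v k :: nat
  define b where "b v k = (if k < v then - \<rho> {k, v} else 0)" for v k :: nat
  define \<tau> where "\<tau> v j = \<rho> {j, v} + (\<Sum>k<d. (s - p j k) * b j k)" for v j :: nat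
  define T where "T v = (\<Sum>j<d. \<tau> v j) / (real d * s - 1)" for v :: nat
  define w where "w v k = (if k < d then if v < d then b v k else s * T v - \<tau> v k else 0)" for v k :: nat
  have pick: "(\<Sum>k<d. p j k * h k) = h j" if "j < d" for j and h :: "nat \<Rightarrow> real"
    using that by (simp add: p_def if_distrib[of "\<lambda>x. x * _"] cong: if_cong)
  have base1: "(\<Sum>k<d. (p u k - p v k)\<^sup>2) = 2" if "u < v" "v < n" "u < d" for u v
  proof -
    have "(\<Sum>k<d. (p u k - p v k)\<^sup>2) = (\<Sum>k<d. p u k * p u k) - 2 * (\<Sum>k<d. p u k * p v k) + (\<Sum>k<d. (p v k)\<^sup>2)"
      by (simp add: power2_eq_square algebra_simps sum.distrib sum_subtractf sum_distrib_left)
    also have "\<dots> = p u u - 2 * p v u + (\<Sum>k<d. (p v k)\<^sup>2)"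
      using pick[OF that(3)] by simp
    also have "\<dots> = 2"
    proof (cases "v < d")
      case True
      then show ?thesis using that pick[OF True, of "p v"] by (simp add: p_def power2_eq_square)
    next
      case False
      then show ?thesis using that s by (simp add: p_def)
    qed
    finally show ?thesis .
  qed
  have first1: "(\<Sum>k<d. (p u k - p v k) * (w u k - w v k)) = \<rho> {u, v}" if "u < v" "v < n" "u < d" for u v
  proof (cases "v < d")
    case True
    have "(\<Sum>k<d. (p u k - p v k) * (w u k - w v k)) = (w u u - w v u) - (w u v - w v v)"
      using pick[OF that(3), of "\<lambda>k. w u k - w v k"] pick[OF True, of "\<lambda>k. w u k - w v k"]
      by (simp only: left_diff_distrib sum_subtractf)
    also have "\<dots> = \<rho> {u, v}" using that True by (simp add: w_def b_def)
    finally show ?thesis .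
  next
    case False
    have sumT: "(\<Sum>k<d. \<tau> v k) = (real d * s - 1) * T v"
      unfolding T_def ds using d by simp
    have "(\<Sum>k<d. w v k) = real d * (s * T v) - (\<Sum>k<d. \<tau> v k)"
      using False by (simp add: w_def sum_subtractf)
    also have "\<dots> = T v" unfolding sumT by (simp add: algebra_simps)
    finally have sumw: "(\<Sum>k<d. w v k) = T v" .
    have "(\<Sum>k<d. (p u k - p v k) * (w u k - w v k)) = (\<Sum>k<d. (s - p u k) * w v k) - (\<Sum>k<d. (s - p u k) * b u k)"
      unfolding sum_subtractf[symmetric] using that False
      by (intro sum.cong refl) (simp add: w_def p_def algebra_simps)
    also have "(\<Sum>k<d. (s - p u k) * w v k) = s * T v - w v u"
      using pick[OF that(3), of "w v"] sumw
      by (simp only: left_diff_distrib sum_subtractf sum_distrib_left[symmetric])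
    also have "\<dots> = \<tau> v u" using that False by (simp add: w_def)
    finally show ?thesis by (simp add: \<tau>_def)
  qed
  show "realizable d {..<n} ?E r"
  proof (rule realizable_of_first_order[where p = p and w = w and \<rho> = \<rho> and c = 2])
    show "simple_graph {..<n} ?E" by (rule simple_graph_clique_join)
    show "(\<Sum>k<d. (p u k - p v k)\<^sup>2) = 2" if "{u, v} \<in> ?E" for u v
      using that
    proof (cases rule: clique_joinE)
      case 1
      then show ?thesis by (rule base1)
    next
      case 2
      have "(\<Sum>k<d. (p u k - p v k)\<^sup>2) = (\<Sum>k<d. (p v k - p u k)\<^sup>2)"
        by (intro sum.cong refl) (simp add: power2_commute)
      then show ?thesis using base1[OF 2] by simp
    qed
    show "(\<Sum>k<d. (p u k - p v k) * (w u k - w v k)) = \<rho> {u, v}" if "{u, v} \<in> ?E" for u v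
      using that
    proof (cases rule: clique_joinE)
      case 1
      then show ?thesis by (rule first1)
    next
      case 2
      have "(\<Sum>k<d. (p u k - p v k) * (w u k - w v k)) = (\<Sum>k<d. (p v k - p u k) * (w v k - w u k))"
        by (intro sum.cong refl) (simp add: algebra_simps)
      then show ?thesis using first1[OF 2] by (simp add: insert_commute)
    qed
    have finE: "finite ?E" unfolding clique_join_def by simp
    show "\<rho> e \<noteq> \<rho> f \<and> ((e, f) \<in> r \<longleftrightarrow> \<rho> e < \<rho> f)" if "e \<in> ?E" "f \<in> ?E" "e \<noteq> f" for e f
      unfolding \<rho>_def by (rule order_rank_iff[OF lin finE that])
    show "{u, v} \<in> ?E \<or> (\<exists>x. {u, x} \<in> ?E \<and> {v, x} \<in> ?E)" if "u \<in> {..<n}" "v \<in> {..<n}" "u \<noteq> v" for u v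
    proof (cases "min u v < d")
      case True
      then show ?thesis using that clique_join_iff[of u v n d] clique_join_iff[of v u n d]
        by (auto simp: insert_commute min_def split: if_splits)
    next
      case False
      then have "{0, u} \<in> ?E" "{0, v} \<in> ?E" using that d by (auto intro!: clique_join_iff)
      then show ?thesis by (auto simp: insert_commute)
    qed
  qed (simp_all add: p_def w_def)
qed

section \<open>The maximal number of edges\<close>

theorem theorem12:
  shows "(\<exists>C::real. \<forall>(d::nat) (n::nat). d \<ge> 1 \<longrightarrow> n \<ge> 1 \<longrightarrow> d * n \<ge> 2 \<longrightarrow>
            real (d choose 2) + real d * (real n - real d)
              = real (d * n) - real ((d + 1) choose 2) \<and>
            real (d * n) - real ((d + 1) choose 2) \<le> real (ex_euclidean d n) \<and>
            real (ex_euclidean d n)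
              \<le> real (d * n) + (2 + 2 * ln 2) * (real (d * n) / ln (real (d * n)))
                 + C * (real (d * n) / (ln (real (d * n)))\<^sup>2))
       \<and> (\<forall>d::nat. d \<ge> 1 \<longrightarrow>
            (\<lambda>n::nat. real (ex_euclidean d n) - real (d * n)) \<in> O(\<lambda>n. real n / ln (real n)))"
proof -
  have lower: "real (d * n) - real ((d + 1) choose 2) \<le> real (ex_euclidean d n)" if "d \<ge> 1" for d n
  proof -
    have "card (clique_join d n) \<in> edge_counts d n"
      unfolding edge_counts_def using simple_graph_clique_join clique_join_all_orders[OF that]
      by (intro CollectI exI[of _ "{..<n}"] exI[of _ "clique_join d n"]) auto
    then have "card (clique_join d n) \<le> ex_euclidean d n"
      unfolding ex_euclidean_def by (rule Max_ge[OF finite_edge_counts])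
    then show ?thesis using card_clique_join[of d n] by linarith
  qed
  have upper: "real (ex_euclidean d n)
      \<le> real (d * n) + (2 + 2 * ln 2) * (real (d * n) / ln (real (d * n)))
        + 128 * (real (d * n) / (ln (real (d * n)))\<^sup>2)" if d: "d \<ge> 1" and dn: "d * n \<ge> 2" for d n
  proof -
    have "ex_euclidean d n \<in> edge_counts d n"
      unfolding ex_euclidean_def by (rule Max_in[OF finite_edge_counts edge_counts_nonempty[OF d]])
    then obtain V :: "nat set" and E where
      "simple_graph V E" "all_orders_realizable d V E" "card V = n" "ex_euclidean d n = card E"
      unfolding edge_counts_def by auto
    then show ?thesis using card_edges_upper_bound[of V E d] dn by simp
  qed
  have binom: "real (d choose 2) + real d * (real n - real d) = real (d * n) - real ((d + 1) choose 2)" for d n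
  proof -
    have "even (d * (d - 1))" by (cases d) auto
    then have "2 * (d choose 2) = d * (d - 1)" by (simp add: choose_two)
    then have "real (2 * (d choose 2)) = real (d * (d - 1))" by simp
    then have "2 * real (d choose 2) = real d * (real d - 1)" by (cases d) (simp_all add: algebra_simps)
    moreover have "(d + 1) choose 2 = (d choose 2) + d" by (simp add: numeral_2_eq_2)
    ultimately show ?thesis by (simp add: algebra_simps)
  qed
  have bigo: "(\<lambda>n::nat. real (ex_euclidean d n) - real (d * n)) \<in> O(\<lambda>n. real n / ln (real n))"
    if d: "d \<ge> 1" for d
  proof -
    define A where "A = (2 + 2 * ln 2 :: real)"
    have A: "A \<ge> 0" unfolding A_def by simp
    define b where "b = real ((d + 1) choose 2)"
    have "norm (real (ex_euclidean d n) - real (d * n)) \<le> (b + (A + 128) * real d) * norm (real n / ln (real n))"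
      if n: "n \<ge> 3" for n
    proof -
      let ?L = "ln (real n)" and ?M = "ln (real (d * n))"
      have "exp 1 \<le> real n" using exp_le n by linarith
      then have L: "?L \<ge> 1" using n by (simp add: ln_ge_iff)
      have "n \<le> d * n" using d by simp
      then have "real n \<le> real (d * n)" by (rule of_nat_mono)
      then have M: "?L \<le> ?M" using n by (intro ln_mono) auto
      have dn: "d * n \<ge> 2" using \<open>n \<le> d * n\<close> n by linarith
      have x1: "1 \<le> real n / ?L" using L ln_le_minus_one[of "real n"] n by (simp add: pos_le_divide_eq)
      have u1: "real (d * n) / ?M \<le> real d * (real n / ?L)"
        using divide_left_mono[OF M, of "real (d * n)"] L M by simp
      have "?L * 1 \<le> ?M * ?M" using L M by (intro mult_mono) auto
      then have u2: "real (d * n) / ?M\<^sup>2 \<le> real d * (real n / ?L)"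
        using divide_left_mono[of ?L "?M\<^sup>2" "real (d * n)"] L M by (simp add: power2_eq_square)
      have "real (ex_euclidean d n) - real (d * n) \<le> A * (real d * (real n / ?L)) + 128 * (real d * (real n / ?L))"
        using upper[OF d dn] mult_left_mono[OF u1 A] u2 unfolding A_def[symmetric] by linarith
      also have "\<dots> = (A + 128) * real d * (real n / ?L)" by (simp add: algebra_simps)
      finally have up: "real (ex_euclidean d n) - real (d * n) \<le> (A + 128) * real d * (real n / ?L)" .
      have lo: "real (d * n) - real (ex_euclidean d n) \<le> b * (real n / ?L)"
        using lower[OF d, of n] mult_left_mono[OF x1, of b] unfolding b_def by simp
      have "0 \<le> real n / ?L" using x1 by linarith
      moreover have "0 \<le> b" "0 \<le> (A + 128) * real d" using A by (simp_all add: b_def)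
      ultimately have "0 \<le> b * (real n / ?L)" "0 \<le> (A + 128) * real d * (real n / ?L)"
        by (blast intro: mult_nonneg_nonneg)+
      then have "\<bar>real (ex_euclidean d n) - real (d * n)\<bar> \<le> b * (real n / ?L) + (A + 128) * real d * (real n / ?L)"
        using up lo by linarith
      also have "\<dots> = (b + (A + 128) * real d) * (real n / ?L)" by (rule distrib_right[symmetric])
      finally show ?thesis using L by simp
    qed
    then show ?thesis
      by (intro bigoI[of _ "b + (A + 128) * real d"] eventually_sequentiallyI[of 3])
  qed
  show ?thesis
    using lower upper binom bigo by (intro conjI exI[of _ 128] allI impI)
qed

end
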